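(* Let $X$ be a set, $\mathcal{C}$ a simplicial complex on $X$, $\mathcal{L}$ a language of regular logic whose variables include $X$, $\vdash$ a regular theory in $\mathcal{L}$, and $[\![-]\!]$ a model of $\vdash$ in a regular category $\mathbf{S}$. Then the inchworm fragment $\vdash_{\mathcal{C}}$ is sound with respect to filter models in $[\![-]\!]$: for all $\Gamma\subseteq\Phi_{\mathcal{C}}$ and $\varphi\in\Phi_{\mathcal{C}}$, if $\Gamma\vdash_{\mathcal{C}}\varphi$ then $G\vDash\varphi$ for every filter model $G$ of $\Gamma$ in $[\![-]\!]$.
   Context: A simplicial complex on $X$ is a family $\mathcal{C}$ of finite subsets of $X$ closed under subsets with $\bigcup\mathcal{C}=X$. $\mathcal{L}$ is a language of regular first-order logic (with $\top$, $\wedge$, $\exists$) whose variables include $X$; each $x\in X$ has a type $T_x$. $\Phi_U$ ($U\subseteq X$) is the set of formulas in context $U$; $\Phi_{\mathcal{C}}=\bigcup_{U\in\mathcal{C}}\Phi_U$; $\Gamma_U=\Gamma\cap\Phi_U$. $\vdash$ is an entailment relation between sets of formulas and formulas. The inchworm fragment $\vdash_{\mathcal{C}}$ is defined inductively: (i) $\Gamma\vdash_{\mathcal{C}}\varphi$ if some $U\in\mathcal{C}$ has $\varphi\in\Phi_U$ and $\Gamma_U\vdash\varphi$; (ii) if $\Gamma\vdash_{\mathcal{C}}\varphi$ and $\Delta\cup\{\varphi\}\vdash_{\mathcal{C}}\psi$ then $\Gamma\cup\Delta\vdash_{\mathcal{C}}\psi$. An interpretation $[\![-]\!]$ of $\mathcal{L}$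 in $\mathbf{S}$ gives $F_U=\prod_{x\in U}[\![T_x]\!]$ with projections $F_{U\subseteq V}:F_V\to F_U$, and subobjects $[\![\varphi]\!]_U\rightarrowtail F_U$ for $\varphi\in\Phi_U$; it is a model of $\vdash$ if whenever $\Gamma\vdash\varphi$ some finite $\Delta\subseteq\Gamma$ has $\bigwedge_{\psi\in\Delta}[\![\psi]\!]_U\leqslant[\![\varphi]\!]_U$. For $f$ an arrow, $f^{-1}$ denotes pullback of subobjects and $\exists_f$ its left adjoint (image). A filter model in $[\![-]\!]$ is a presheaf $G:\mathcal{C}^{\mathrm{op}}\to\mathbf{Sets}$ such that each $G_U$ is a filter in the meet-semilattice $\mathrm{Sub}_{\mathbf{S}}(F_U)$, and for $U\subseteq V\in\mathcal{C}$, $G_U=\{S\rightarrowtail F_U\mid F_{U\subseteq V}^{-1}(S)\in G_V\}=\{\exists_{F_{U\subseteq V}}(S)\mid S\in G_V\}$, with $G_{U\subseteq V}:S\mapsto\exists_{F_{U\subseteq V}}(S)$. $G\vDash\varphi$ means $[\![\varphi]\!]_U\in G_U$ whenever $U\in\mathcal{C}$ and $\varphi\in\Phi_U$; $G$ is a filter model of $\Gamma$ if $G\vDash\psi$ for all $\psi\in\Gamma$. *)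

theory Defs
  imports "HOL-Algebra.Galois_Connection"
begin

section \<open>Regular categories\<close>

record ('o, 'a) cat =
  Ob :: "'o set"
  Ar :: "'a set"
  Dom :: "'a \<Rightarrow> 'o"
  Cod :: "'a \<Rightarrow> 'o"
  Idn :: "'o \<Rightarrow> 'a"
  Comp :: "'a \<Rightarrow> 'a \<Rightarrow> 'a" (infixr \<open>\<cdot>\<index>\<close> 75)

definition hom :: "('o, 'a) cat \<Rightarrow> 'o \<Rightarrow> 'o \<Rightarrow> 'a set" where
  "hom C A B = {f \<in> Ar C. Dom C f = A \<and> Cod C f = B}"

locale category =
  fixes C :: "('o, 'a) cat" (structure)
  assumes dom_ob: "f \<in> Ar C \<Longrightarrow> Dom C f \<in> Ob C"
    and cod_ob: "f \<in> Ar C \<Longrightarrow> Cod C f \<in> Ob C"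
    and id_hom: "A \<in> Ob C \<Longrightarrow> Idn C A \<in> hom C A A"
    and comp_hom: "f \<in> hom C A B \<Longrightarrow> g \<in> hom C B D \<Longrightarrow> g \<cdot> f \<in> hom C A D"
    and comp_id: "f \<in> hom C A B \<Longrightarrow> f \<cdot> Idn C A = f"
    and id_comp: "f \<in> hom C A B \<Longrightarrow> Idn C B \<cdot> f = f"
    and comp_assoc: "f \<in> hom C A B \<Longrightarrow> g \<in> hom C B D \<Longrightarrow> h \<in> hom C D E \<Longrightarrow>
      (h \<cdot> g) \<cdot> f = h \<cdot> (g \<cdot> f)"

definition is_mono :: "('o, 'a) cat \<Rightarrow> 'a \<Rightarrow> bool" where
  "is_mono C m \<longleftrightarrow> m \<in> Ar C \<and>
     (\<forall>A. \<forall>u \<in> hom C A (Dom C m). \<forall>v \<in> hom C A (Dom C m).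
        m \<cdot>\<^bsub>C\<^esub> u = m \<cdot>\<^bsub>C\<^esub> v \<longrightarrow> u = v)"

definition is_terminal :: "('o, 'a) cat \<Rightarrow> 'o \<Rightarrow> bool" where
  "is_terminal C T \<longleftrightarrow> T \<in> Ob C \<and> (\<forall>A \<in> Ob C. \<exists>!h. h \<in> hom C A T)"

definition is_pullback :: "('o, 'a) cat \<Rightarrow> 'a \<Rightarrow> 'a \<Rightarrow> 'a \<Rightarrow> 'a \<Rightarrow> bool" where
  "is_pullback C f g p q \<longleftrightarrow>
     f \<in> Ar C \<and> g \<in> Ar C \<and> Cod C f = Cod C g \<and> Dom C p = Dom C q \<and>
     p \<in> hom C (Dom C p) (Dom C f) \<and> q \<in> hom C (Dom C p) (Dom C g) \<and>
     f \<cdot>\<^bsub>C\<^esub> p = g \<cdot>\<^bsub>C\<^esub> q \<and>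
     (\<forall>A. \<forall>a \<in> hom C A (Dom C f). \<forall>b \<in> hom C A (Dom C g).
        f \<cdot>\<^bsub>C\<^esub> a = g \<cdot>\<^bsub>C\<^esub> b \<longrightarrow>
        (\<exists>!h. h \<in> hom C A (Dom C p) \<and> p \<cdot>\<^bsub>C\<^esub> h = a \<and> q \<cdot>\<^bsub>C\<^esub> h = b))"

definition is_equalizer :: "('o, 'a) cat \<Rightarrow> 'a \<Rightarrow> 'a \<Rightarrow> 'a \<Rightarrow> bool" where
  "is_equalizer C f g e \<longleftrightarrow>
     (\<exists>A B. f \<in> hom C A B \<and> g \<in> hom C A B \<and> e \<in> hom C (Dom C e) A \<and>
       f \<cdot>\<^bsub>C\<^esub> e = g \<cdot>\<^bsub>C\<^esub> e \<and>
       (\<forall>D. \<forall>d \<in> hom C D A. f \<cdot>\<^bsub>C\<^esub> d = g \<cdot>\<^bsub>C\<^esub> d \<longrightarrow>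
          (\<exists>!h. h \<in> hom C D (Dom C e) \<and> e \<cdot>\<^bsub>C\<^esub> h = d)))"

definition is_coequalizer :: "('o, 'a) cat \<Rightarrow> 'a \<Rightarrow> 'a \<Rightarrow> 'a \<Rightarrow> bool" where
  "is_coequalizer C f g e \<longleftrightarrow>
     (\<exists>A B. f \<in> hom C A B \<and> g \<in> hom C A B \<and> e \<in> hom C B (Cod C e) \<and>
       e \<cdot>\<^bsub>C\<^esub> f = e \<cdot>\<^bsub>C\<^esub> g \<and>
       (\<forall>D. \<forall>d \<in> hom C B D. d \<cdot>\<^bsub>C\<^esub> f = d \<cdot>\<^bsub>C\<^esub> g \<longrightarrow>
          (\<exists>!h. h \<in> hom C (Cod C e) D \<and> h \<cdot>\<^bsub>C\<^esub> e = d)))"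

definition regular_epi :: "('o, 'a) cat \<Rightarrow> 'a \<Rightarrow> bool" where
  "regular_epi C e \<longleftrightarrow> (\<exists>f g. is_coequalizer C f g e)"

text \<open>
  Finite completeness is expressed by a terminal object and pullbacks; the kernel pair of \<open>f\<close>
  is the pullback of \<open>f\<close> along itself.
\<close>

locale regular_category = category C for C :: "('o, 'a) cat" (structure) +
  assumes has_terminal: "\<exists>T. is_terminal C T"
    and has_pullbacks: "f \<in> hom C A D \<Longrightarrow> g \<in> hom C B D \<Longrightarrow> \<exists>p q. is_pullback C f g p q"
    and kernel_pair_coequalizer: "is_pullback C f f p q \<Longrightarrow> \<exists>e. is_coequalizer C p q e"
    and regular_epi_stable: "regular_epi C e \<Longrightarrow> is_pullback C f e p q \<Longrightarrow> regular_epi C p"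


subsection \<open>Finite products\<close>

definition is_product ::
  "('o, 'a) cat \<Rightarrow> 'i set \<Rightarrow> ('i \<Rightarrow> 'o) \<Rightarrow> 'o \<Rightarrow> ('i \<Rightarrow> 'a) \<Rightarrow> bool" where
  "is_product C I D P \<pi> \<longleftrightarrow> P \<in> Ob C \<and> (\<forall>i \<in> I. \<pi> i \<in> hom C P (D i)) \<and>
     (\<forall>A \<in> Ob C. \<forall>f. (\<forall>i \<in> I. f i \<in> hom C A (D i)) \<longrightarrow>
        (\<exists>!h. h \<in> hom C A P \<and> (\<forall>i \<in> I. \<pi> i \<cdot>\<^bsub>C\<^esub> h = f i)))"

definition product :: "('o, 'a) cat \<Rightarrow> 'i set \<Rightarrow> ('i \<Rightarrow> 'o) \<Rightarrow> 'o \<times> ('i \<Rightarrow> 'a)" where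
  "product C I D = (SOME (P, \<pi>). is_product C I D P \<pi>)"

definition prod_obj :: "('o, 'a) cat \<Rightarrow> 'i set \<Rightarrow> ('i \<Rightarrow> 'o) \<Rightarrow> 'o" where
  "prod_obj C I D = fst (product C I D)"

definition prod_proj :: "('o, 'a) cat \<Rightarrow> 'i set \<Rightarrow> ('i \<Rightarrow> 'o) \<Rightarrow> 'i \<Rightarrow> 'a" where
  "prod_proj C I D = snd (product C I D)"

definition tuple ::
  "('o, 'a) cat \<Rightarrow> 'i set \<Rightarrow> ('i \<Rightarrow> 'o) \<Rightarrow> 'o \<Rightarrow> ('i \<Rightarrow> 'a) \<Rightarrow> 'a" where
  "tuple C I D A f = (THE h. h \<in> hom C A (prod_obj C I D) \<and>
     (\<forall>i \<in> I. prod_proj C I D i \<cdot>\<^bsub>C\<^esub> h = f i))"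


subsection \<open>Subobjects\<close>

definition factors :: "('o, 'a) cat \<Rightarrow> 'a \<Rightarrow> 'a \<Rightarrow> bool" where
  "factors C m n \<longleftrightarrow> (\<exists>h \<in> hom C (Dom C m) (Dom C n). n \<cdot>\<^bsub>C\<^esub> h = m)"

definition monos_into :: "('o, 'a) cat \<Rightarrow> 'o \<Rightarrow> 'a set" where
  "monos_into C A = {m. is_mono C m \<and> Cod C m = A}"

definition mono_equiv :: "('o, 'a) cat \<Rightarrow> 'o \<Rightarrow> ('a \<times> 'a) set" where
  "mono_equiv C A = {(m, n) \<in> monos_into C A \<times> monos_into C A. factors C m n \<and> factors C n m}"

definition Sub :: "('o, 'a) cat \<Rightarrow> 'o \<Rightarrow> 'a set gorder" where
  "Sub C A = \<lparr>carrier = monos_into C A // mono_equiv C A, eq = (=),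
     le = (\<lambda>S T. \<exists>m \<in> S. \<exists>n \<in> T. factors C m n)\<rparr>"

text \<open>
  All pullbacks along \<open>f\<close> of all representatives of \<open>S\<close>: since pullbacks are unique only up to
  isomorphism, this set is itself an equivalence class of monomorphisms.
\<close>

definition sub_pullback :: "('o, 'a) cat \<Rightarrow> 'a \<Rightarrow> 'a set \<Rightarrow> 'a set" where
  "sub_pullback C f S = {n. \<exists>m \<in> S. \<exists>q. is_pullback C f m n q}"

definition sub_image :: "('o, 'a) cat \<Rightarrow> 'a \<Rightarrow> 'a set \<Rightarrow> 'a set" where
  "sub_image C f = (SOME e. galois_connection
     \<lparr>orderA = Sub C (Dom C f), orderB = Sub C (Cod C f), lower = e, upper = sub_pullback C f\<rparr>)"

definition is_filter :: "'b gorder \<Rightarrow> 'b set \<Rightarrow> bool" where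
  "is_filter L F \<longleftrightarrow> F \<subseteq> carrier L \<and> F \<noteq> {} \<and>
     (\<forall>S \<in> F. \<forall>T \<in> F. S \<sqinter>\<^bsub>L\<^esub> T \<in> F) \<and>
     (\<forall>S \<in> F. \<forall>T \<in> carrier L. S \<sqsubseteq>\<^bsub>L\<^esub> T \<longrightarrow> T \<in> F)"


section \<open>Regular logic\<close>

text \<open>The variables of the language are the elements of the type \<open>'v\<close>.\<close>

record ('s, 'f, 'r, 'v) lang =
  var_type :: "'v \<Rightarrow> 's"
  fn_args :: "'f \<Rightarrow> 's list"
  fn_res :: "'f \<Rightarrow> 's"
  rel_args :: "'r \<Rightarrow> 's list"

datatype ('f, 'v) tm = Var 'v | Fn 'f "('f, 'v) tm list"

datatype ('f, 'r, 'v) fm =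
    Rel 'r "('f, 'v) tm list"
  | Equal "('f, 'v) tm" "('f, 'v) tm"
  | Truth
  | And "('f, 'r, 'v) fm" "('f, 'r, 'v) fm"
  | Ex 'v "('f, 'r, 'v) fm"

inductive has_type :: "('s, 'f, 'r, 'v) lang \<Rightarrow> ('f, 'v) tm \<Rightarrow> 's \<Rightarrow> bool" for L where
  "has_type L (Var x) (var_type L x)"
| "list_all2 (has_type L) ts (fn_args L f) \<Longrightarrow> has_type L (Fn f ts) (fn_res L f)"

primrec wf_fm :: "('s, 'f, 'r, 'v) lang \<Rightarrow> ('f, 'r, 'v) fm \<Rightarrow> bool" where
  "wf_fm L (Rel r ts) \<longleftrightarrow> list_all2 (has_type L) ts (rel_args L r)"
| "wf_fm L (Equal s t) \<longleftrightarrow> (\<exists>T. has_type L s T \<and> has_type L t T)"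
| "wf_fm L Truth \<longleftrightarrow> True"
| "wf_fm L (And \<phi> \<psi>) \<longleftrightarrow> wf_fm L \<phi> \<and> wf_fm L \<psi>"
| "wf_fm L (Ex x \<phi>) \<longleftrightarrow> wf_fm L \<phi>"

primrec tm_vars :: "('f, 'v) tm \<Rightarrow> 'v set" where
  "tm_vars (Var x) = {x}"
| "tm_vars (Fn f ts) = \<Union> (set (map tm_vars ts))"

primrec free_vars :: "('f, 'r, 'v) fm \<Rightarrow> 'v set" where
  "free_vars (Rel r ts) = (\<Union>t \<in> set ts. tm_vars t)"
| "free_vars (Equal s t) = tm_vars s \<union> tm_vars t"
| "free_vars Truth = {}"
| "free_vars (And \<phi> \<psi>) = free_vars \<phi> \<union> free_vars \<psi>"
| "free_vars (Ex x \<phi>) = free_vars \<phi> - {x}"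

definition fms_in :: "('s, 'f, 'r, 'v) lang \<Rightarrow> 'v set \<Rightarrow> ('f, 'r, 'v) fm set" where
  "fms_in L U = {\<phi>. wf_fm L \<phi> \<and> free_vars \<phi> \<subseteq> U}"


subsection \<open>Substitution\<close>

text \<open>
  Textual substitution of \<open>t\<close> for the free occurrences of \<open>x\<close>; it is only ever used when \<open>t\<close> is
  free for \<open>x\<close>, so that no variable of \<open>t\<close> is captured.
\<close>

primrec subst_tm :: "'v \<Rightarrow> ('f, 'v) tm \<Rightarrow> ('f, 'v) tm \<Rightarrow> ('f, 'v) tm" where
  "subst_tm x t (Var y) = (if y = x then t else Var y)"
| "subst_tm x t (Fn f ts) = Fn f (map (subst_tm x t) ts)"

primrec subst :: "'v \<Rightarrow> ('f, 'v) tm \<Rightarrow> ('f, 'r, 'v) fm \<Rightarrow> ('f, 'r, 'v) fm" where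
  "subst x t (Rel r ts) = Rel r (map (subst_tm x t) ts)"
| "subst x t (Equal s s') = Equal (subst_tm x t s) (subst_tm x t s')"
| "subst x t Truth = Truth"
| "subst x t (And \<phi> \<psi>) = And (subst x t \<phi>) (subst x t \<psi>)"
| "subst x t (Ex y \<phi>) = (if y = x then Ex y \<phi> else Ex y (subst x t \<phi>))"

primrec free_for :: "'v \<Rightarrow> ('f, 'v) tm \<Rightarrow> ('f, 'r, 'v) fm \<Rightarrow> bool" where
  "free_for x t (Rel r ts) \<longleftrightarrow> True"
| "free_for x t (Equal s s') \<longleftrightarrow> True"
| "free_for x t Truth \<longleftrightarrow> True"
| "free_for x t (And \<phi> \<psi>) \<longleftrightarrow> free_for x t \<phi> \<and> free_for x t \<psi>"
| "free_for x t (Ex y \<phi>) \<longleftrightarrow> x \<notin> free_vars (Ex y \<phi>) \<or> (y \<notin> tm_vars t \<and> free_for x t \<phi>)"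

definition substitutable ::
  "('s, 'f, 'r, 'v) lang \<Rightarrow> 'v \<Rightarrow> ('f, 'v) tm \<Rightarrow> ('f, 'r, 'v) fm \<Rightarrow> bool" where
  "substitutable L x t \<phi> \<longleftrightarrow> has_type L t (var_type L x) \<and> free_for x t \<phi>"


subsection \<open>Regular theories\<close>

text \<open>
  A sequent \<open>\<Gamma> \<turnstile> \<phi>\<close> is read in the context of its own free variables. As types may be interpreted
  by objects without global support (``empty'' types), \<open>cut\<close> and \<open>ex_intro\<close> are demanded only when
  no variable of the premises is lost from the context. Every relation closed under the rules
  without these provisos is also a regular theory in the present sense.
\<close>

locale regular_theory =
  fixes L :: "('s, 'f, 'r, 'v) lang"
    and ent :: "('f, 'r, 'v) fm set \<Rightarrow> ('f, 'r, 'v) fm \<Rightarrow> bool" (infix \<open>\<turnstile>\<close> 45)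
  assumes wf_fms: "\<Gamma> \<turnstile> \<phi> \<Longrightarrow> insert \<phi> \<Gamma> \<subseteq> fms_in L UNIV"
    and refl: "\<phi> \<in> fms_in L UNIV \<Longrightarrow> {\<phi>} \<turnstile> \<phi>"
    and weaken: "\<Gamma> \<turnstile> \<phi> \<Longrightarrow> \<Gamma> \<subseteq> \<Delta> \<Longrightarrow> \<Delta> \<subseteq> fms_in L UNIV \<Longrightarrow> \<Delta> \<turnstile> \<phi>"
    and cut: "\<Gamma> \<turnstile> \<phi> \<Longrightarrow> insert \<phi> \<Delta> \<turnstile> \<psi> \<Longrightarrow>
      free_vars \<phi> \<subseteq> \<Union> (free_vars ` insert \<psi> (\<Gamma> \<union> \<Delta>)) \<Longrightarrow> \<Gamma> \<union> \<Delta> \<turnstile> \<psi>"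
    and substitution: "\<Gamma> \<turnstile> \<phi> \<Longrightarrow> (\<And>\<psi>. \<psi> \<in> insert \<phi> \<Gamma> \<Longrightarrow> substitutable L x t \<psi>) \<Longrightarrow>
      subst x t ` \<Gamma> \<turnstile> subst x t \<phi>"
    and truth_intro: "{} \<turnstile> Truth"
    and and_intro: "\<phi> \<in> fms_in L UNIV \<Longrightarrow> \<psi> \<in> fms_in L UNIV \<Longrightarrow> {\<phi>, \<psi>} \<turnstile> And \<phi> \<psi>"
    and and_elim1: "And \<phi> \<psi> \<in> fms_in L UNIV \<Longrightarrow> {And \<phi> \<psi>} \<turnstile> \<phi>"
    and and_elim2: "And \<phi> \<psi> \<in> fms_in L UNIV \<Longrightarrow> {And \<phi> \<psi>} \<turnstile> \<psi>"
    and ex_intro: "\<Gamma> \<subseteq> fms_in L UNIV \<Longrightarrow> wf_fm L \<phi> \<Longrightarrow> substitutable L x t \<phi> \<Longrightarrow>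
      subst x t \<phi> \<in> \<Gamma> \<Longrightarrow> tm_vars t \<subseteq> \<Union> (free_vars ` \<Gamma>) \<Longrightarrow> \<Gamma> \<turnstile> Ex x \<phi>"
    and ex_elim: "insert \<phi> \<Gamma> \<turnstile> \<psi> \<Longrightarrow> x \<notin> \<Union> (free_vars ` insert \<psi> \<Gamma>) \<Longrightarrow>
      insert (Ex x \<phi>) \<Gamma> \<turnstile> \<psi>"
    and equal_refl: "has_type L t T \<Longrightarrow> {} \<turnstile> Equal t t"
    and equal_subst: "\<phi> \<in> fms_in L UNIV \<Longrightarrow> substitutable L x s \<phi> \<Longrightarrow> substitutable L x t \<phi> \<Longrightarrow>
      {Equal s t, subst x s \<phi>} \<turnstile> subst x t \<phi>"


section \<open>Interpretations and models\<close>

record ('o, 'a, 's, 'f, 'r) interp =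
  ty_obj :: "'s \<Rightarrow> 'o"
  fn_arr :: "'f \<Rightarrow> 'a"
  rel_sub :: "'r \<Rightarrow> 'a set"

definition args_prod :: "('o, 'a) cat \<Rightarrow> ('o, 'a, 's, 'f, 'r) interp \<Rightarrow> 's list \<Rightarrow> 'o" where
  "args_prod C I Ts = prod_obj C {..<length Ts} (\<lambda>i. ty_obj I (Ts ! i))"

definition args_tuple ::
  "('o, 'a) cat \<Rightarrow> ('o, 'a, 's, 'f, 'r) interp \<Rightarrow> 's list \<Rightarrow> 'o \<Rightarrow> 'a list \<Rightarrow> 'a" where
  "args_tuple C I Ts A fs = tuple C {..<length Ts} (\<lambda>i. ty_obj I (Ts ! i)) A (\<lambda>i. fs ! i)"

definition is_interp ::
  "('o, 'a) cat \<Rightarrow> ('s, 'f, 'r, 'v) lang \<Rightarrow> ('o, 'a, 's, 'f, 'r) interp \<Rightarrow> bool" where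
  "is_interp C L I \<longleftrightarrow>
     (\<forall>T. ty_obj I T \<in> Ob C) \<and>
     (\<forall>f. fn_arr I f \<in> hom C (args_prod C I (fn_args L f)) (ty_obj I (fn_res L f))) \<and>
     (\<forall>r. rel_sub I r \<in> carrier (Sub C (args_prod C I (rel_args L r))))"

definition ctx ::
  "('o, 'a) cat \<Rightarrow> ('s, 'f, 'r, 'v) lang \<Rightarrow> ('o, 'a, 's, 'f, 'r) interp \<Rightarrow> 'v set \<Rightarrow> 'o" where
  "ctx C L I U = prod_obj C U (\<lambda>x. ty_obj I (var_type L x))"

definition ctx_var ::
  "('o, 'a) cat \<Rightarrow> ('s, 'f, 'r, 'v) lang \<Rightarrow> ('o, 'a, 's, 'f, 'r) interp \<Rightarrow> 'v set \<Rightarrow> 'v \<Rightarrow> 'a" where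
  "ctx_var C L I U = prod_proj C U (\<lambda>x. ty_obj I (var_type L x))"

text \<open>The projection from the product over \<open>V\<close> to the product over \<open>U \<subseteq> V\<close>.\<close>

definition ctx_proj ::
  "('o, 'a) cat \<Rightarrow> ('s, 'f, 'r, 'v) lang \<Rightarrow> ('o, 'a, 's, 'f, 'r) interp \<Rightarrow> 'v set \<Rightarrow> 'v set \<Rightarrow> 'a"
where
  "ctx_proj C L I U V =
     tuple C U (\<lambda>x. ty_obj I (var_type L x)) (ctx C L I V) (ctx_var C L I V)"

primrec tm_arr ::
  "('o, 'a) cat \<Rightarrow> ('s, 'f, 'r, 'v) lang \<Rightarrow> ('o, 'a, 's, 'f, 'r) interp \<Rightarrow> 'v set \<Rightarrow>
     ('f, 'v) tm \<Rightarrow> 'a" where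
  "tm_arr C L I U (Var x) = ctx_var C L I U x"
| "tm_arr C L I U (Fn f ts) =
     fn_arr I f \<cdot>\<^bsub>C\<^esub> args_tuple C I (fn_args L f) (ctx C L I U) (map (tm_arr C L I U) ts)"

text \<open>
  In the case of \<open>Ex x \<phi>\<close> with \<open>x \<in> U\<close>, the bound variable shadows the variable \<open>x\<close> of the context:
  the formula is interpreted over \<open>U - {x}\<close>, and the result is weakened to \<open>U\<close>. The set of all
  equalizers of two arrows is an equivalence class of monomorphisms.
\<close>

primrec fm_sub ::
  "('o, 'a) cat \<Rightarrow> ('s, 'f, 'r, 'v) lang \<Rightarrow> ('o, 'a, 's, 'f, 'r) interp \<Rightarrow>
     ('f, 'r, 'v) fm \<Rightarrow> 'v set \<Rightarrow> 'a set" where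
  "fm_sub C L I (Rel r ts) U = sub_pullback C
     (args_tuple C I (rel_args L r) (ctx C L I U) (map (tm_arr C L I U) ts)) (rel_sub I r)"
| "fm_sub C L I (Equal s t) U = {e. is_equalizer C (tm_arr C L I U s) (tm_arr C L I U t) e}"
| "fm_sub C L I Truth U = \<top>\<^bsub>Sub C (ctx C L I U)\<^esub>"
| "fm_sub C L I (And \<phi> \<psi>) U = fm_sub C L I \<phi> U \<sqinter>\<^bsub>Sub C (ctx C L I U)\<^esub> fm_sub C L I \<psi> U"
| "fm_sub C L I (Ex x \<phi>) U =
     (if x \<notin> U
      then sub_image C (ctx_proj C L I U (insert x U)) (fm_sub C L I \<phi> (insert x U))
      else sub_pullback C (ctx_proj C L I (U - {x}) U)
             (sub_image C (ctx_proj C L I (U - {x}) U) (fm_sub C L I \<phi> U)))"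

text \<open>
  The entailment relation does not mention contexts, so the required inequality is demanded in
  every finite context \<open>U\<close> to which the formulas involved belong.
\<close>

definition is_model ::
  "('o, 'a) cat \<Rightarrow> ('s, 'f, 'r, 'v) lang \<Rightarrow> ('o, 'a, 's, 'f, 'r) interp \<Rightarrow>
     (('f, 'r, 'v) fm set \<Rightarrow> ('f, 'r, 'v) fm \<Rightarrow> bool) \<Rightarrow> bool" where
  "is_model C L I ent \<longleftrightarrow> is_interp C L I \<and>
     (\<forall>\<Gamma> \<phi>. ent \<Gamma> \<phi> \<longrightarrow>
        (\<exists>\<Delta>. finite \<Delta> \<and> \<Delta> \<subseteq> \<Gamma> \<and>
          (\<forall>U. finite U \<and> insert \<phi> \<Delta> \<subseteq> fms_in L U \<longrightarrow>
             \<Sqinter>\<^bsub>Sub C (ctx C L I U)\<^esub> ((\<lambda>\<psi>. fm_sub C L I \<psi> U) ` \<Delta>)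
               \<sqsubseteq>\<^bsub>Sub C (ctx C L I U)\<^esub> fm_sub C L I \<phi> U)))"


section \<open>The inchworm fragment and filter models\<close>

definition simplicial_complex :: "'v set \<Rightarrow> 'v set set \<Rightarrow> bool" where
  "simplicial_complex X K \<longleftrightarrow>
     (\<forall>U \<in> K. finite U) \<and> (\<forall>V \<in> K. \<forall>U. U \<subseteq> V \<longrightarrow> U \<in> K) \<and> \<Union> K = X"

definition fms_over :: "('s, 'f, 'r, 'v) lang \<Rightarrow> 'v set set \<Rightarrow> ('f, 'r, 'v) fm set" where
  "fms_over L K = (\<Union>U \<in> K. fms_in L U)"

inductive inchworm ::
  "('s, 'f, 'r, 'v) lang \<Rightarrow> (('f, 'r, 'v) fm set \<Rightarrow> ('f, 'r, 'v) fm \<Rightarrow> bool) \<Rightarrow> 'v set set \<Rightarrow>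
     ('f, 'r, 'v) fm set \<Rightarrow> ('f, 'r, 'v) fm \<Rightarrow> bool"
  for L ent K where
  base: "\<Gamma> \<subseteq> fms_over L K \<Longrightarrow> U \<in> K \<Longrightarrow> \<phi> \<in> fms_in L U \<Longrightarrow> ent (\<Gamma> \<inter> fms_in L U) \<phi> \<Longrightarrow>
    inchworm L ent K \<Gamma> \<phi>"
| cut: "inchworm L ent K \<Gamma> \<phi> \<Longrightarrow> inchworm L ent K (insert \<phi> \<Delta>) \<psi> \<Longrightarrow>
    inchworm L ent K (\<Gamma> \<union> \<Delta>) \<psi>"

definition presheaf_on :: "'v set set \<Rightarrow> ('v set \<Rightarrow> 'b set) \<Rightarrow> ('v set \<Rightarrow> 'v set \<Rightarrow> 'b \<Rightarrow> 'b) \<Rightarrow> bool"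
where
  "presheaf_on K G r \<longleftrightarrow>
     (\<forall>U V. U \<subseteq> V \<and> V \<in> K \<longrightarrow> r U V \<in> G V \<rightarrow> G U) \<and>
     (\<forall>U \<in> K. \<forall>S \<in> G U. r U U S = S) \<and>
     (\<forall>U V W. U \<subseteq> V \<and> V \<subseteq> W \<and> W \<in> K \<longrightarrow> (\<forall>S \<in> G W. r U V (r V W S) = r U W S))"

definition filter_model ::
  "('o, 'a) cat \<Rightarrow> ('s, 'f, 'r, 'v) lang \<Rightarrow> ('o, 'a, 's, 'f, 'r) interp \<Rightarrow> 'v set set \<Rightarrow>
     ('v set \<Rightarrow> 'a set set) \<Rightarrow> bool" where
  "filter_model C L I K G \<longleftrightarrow>
     presheaf_on K G (\<lambda>U V. sub_image C (ctx_proj C L I U V)) \<and>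
     (\<forall>U \<in> K. is_filter (Sub C (ctx C L I U)) (G U)) \<and>
     (\<forall>U V. U \<subseteq> V \<and> V \<in> K \<longrightarrow>
        G U = {S \<in> carrier (Sub C (ctx C L I U)). sub_pullback C (ctx_proj C L I U V) S \<in> G V} \<and>
        G U = sub_image C (ctx_proj C L I U V) ` G V)"

definition filter_sat ::
  "('o, 'a) cat \<Rightarrow> ('s, 'f, 'r, 'v) lang \<Rightarrow> ('o, 'a, 's, 'f, 'r) interp \<Rightarrow> 'v set set \<Rightarrow>
     ('v set \<Rightarrow> 'a set set) \<Rightarrow> ('f, 'r, 'v) fm \<Rightarrow> bool" where
  "filter_sat C L I K G \<phi> \<longleftrightarrow> (\<forall>U \<in> K. \<phi> \<in> fms_in L U \<longrightarrow> fm_sub C L I \<phi> U \<in> G U)"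

definition filter_model_of ::
  "('o, 'a) cat \<Rightarrow> ('s, 'f, 'r, 'v) lang \<Rightarrow> ('o, 'a, 's, 'f, 'r) interp \<Rightarrow> 'v set set \<Rightarrow>
     ('f, 'r, 'v) fm set \<Rightarrow> ('v set \<Rightarrow> 'a set set) \<Rightarrow> bool" where
  "filter_model_of C L I K \<Gamma> G \<longleftrightarrow>
     filter_model C L I K G \<and> (\<forall>\<psi> \<in> \<Gamma>. filter_sat C L I K G \<psi>)"

end

theory Submission
  imports Defs
begin

text \<open>
  If a formula \<open>\<phi>\<close> can be read in two contexts \<open>U, V \<in> K\<close>, then it can already be read in
  \<open>U \<inter> V\<close>, and its interpretations in \<open>U\<close> and \<open>V\<close> are the pullbacks of the one in
  \<open>U \<inter> V\<close> along the projections. By the first of the two equations for \<open>G\<^sub>U\<close> it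
  therefore belongs to \<open>G\<^sub>U\<close> iff it belongs to \<open>G\<^sub>V\<close>, so that validity in a filter model need
  only be checked in one context. For a base step this context is the \<open>U\<close> in which the entailment
  takes place; there the finite meet of the premises lies in the filter \<open>G\<^sub>U\<close> and is below the
  conclusion.

  The stability of interpretations under pullback is seen from generalized elements: a subobject is
  determined by the arrows that factor through it, and an arrow into a context factors through
  \<open>\<lbrakk>\<phi>\<rbrakk>\<close> iff it forces \<open>\<phi>\<close>, where the forcing relation, with existentials witnessed along a
  regular epimorphism, depends only on the components of the arrow at the free variables of \<open>\<phi>\<close>.
\<close>


section \<open>Subobjects as sieves of generalized elements\<close>

text \<open>Membership of the generalized element \<open>k\<close> in the subobject
  \<open>S\<close>. When \<open>S\<close> is a class of monomorphisms, \<open>lies_in_iff\<close>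
  allows any one representative to be tested.\<close>

definition lies_in :: "('o, 'a) cat \<Rightarrow> 'a \<Rightarrow> 'a set \<Rightarrow> bool" where
  "lies_in C k S \<longleftrightarrow> (\<exists>m \<in> S. factors C k m)"

text \<open>The set of all monomorphisms that represent the sieve \<open>P\<close>. Taking all of
  them makes it literally equal to the sets of pullbacks and of equalizers in the semantics. It is
  empty if \<open>P\<close> is not representable, so that results about it assume a member.\<close>

definition sub_of :: "('o, 'a) cat \<Rightarrow> 'o \<Rightarrow> ('a \<Rightarrow> bool) \<Rightarrow> 'a set" where
  "sub_of C A P = {m \<in> monos_into C A. \<forall>k \<in> Ar C. Cod C k = A \<longrightarrow> (factors C k m \<longleftrightarrow> P k)}"

section \<open>Elementary facts on arrows, monomorphisms and factorization\<close>

lemma homD: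
  assumes "f \<in> hom C A B"
  shows "f \<in> Ar C" "Dom C f = A" "Cod C f = B"
  using assms by (simp_all add: hom_def)

lemma monoD:
  assumes "is_mono C m" "u \<in> hom C A (Dom C m)" "v \<in> hom C A (Dom C m)"
    and "m \<cdot>\<^bsub>C\<^esub> u = m \<cdot>\<^bsub>C\<^esub> v"
  shows "u = v"
  using assms unfolding is_mono_def by blast

lemma monos_into_hom: "m \<in> monos_into C A \<Longrightarrow> m \<in> hom C (Dom C m) A"
  by (auto simp: monos_into_def is_mono_def hom_def)

lemma monos_into_mono: "m \<in> monos_into C A \<Longrightarrow> is_mono C m"
  by (simp add: monos_into_def)

lemma sub_of_factors: "m \<in> sub_of C A P \<Longrightarrow> k \<in> hom C B A \<Longrightarrow> factors C k m \<longleftrightarrow> P k"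
  by (auto simp: sub_of_def dest: homD)

lemma sub_of_monos: "m \<in> sub_of C A P \<Longrightarrow> m \<in> monos_into C A"
  by (simp add: sub_of_def)

lemma sub_of_hom: "m \<in> sub_of C A P \<Longrightarrow> m \<in> hom C (Dom C m) A"
  by (rule monos_into_hom[OF sub_of_monos])

lemma sub_ofI:
  "m \<in> monos_into C A \<Longrightarrow> (\<And>B k. k \<in> hom C B A \<Longrightarrow> factors C k m \<longleftrightarrow> P k) \<Longrightarrow> m \<in> sub_of C A P"
  by (simp add: sub_of_def hom_def)

lemma sub_of_cong: "(\<And>B k. k \<in> hom C B A \<Longrightarrow> P k \<longleftrightarrow> Q k) \<Longrightarrow> sub_of C A P = sub_of C A Q"
  by (auto simp: sub_of_def hom_def)

context category
begin

lemma hom_ob: "f \<in> hom C A B \<Longrightarrow> A \<in> Ob C" "f \<in> hom C A B \<Longrightarrow> B \<in> Ob C"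
  using dom_ob cod_ob by (auto simp: hom_def)

lemma factorsI: "h \<in> hom C B M \<Longrightarrow> n \<in> hom C M A \<Longrightarrow> factors C (n \<cdot> h) n"
  unfolding factors_def using comp_hom homD by metis

lemma factorsE:
  assumes "factors C k m" "k \<in> hom C B A" "m \<in> hom C M A"
  obtains h where "h \<in> hom C B M" "m \<cdot> h = k"
  using assms unfolding factors_def by (auto simp: homD)

lemma factors_refl: "m \<in> hom C B A \<Longrightarrow> factors C m m"
  by (metis factorsI comp_id id_hom hom_ob(1))

lemma factors_comp:
  assumes k: "factors C k m" "k \<in> hom C B A" and m: "m \<in> hom C M A" and h: "h \<in> hom C B' B"
  shows "factors C (k \<cdot> h) m"
proof -
  obtain l where l: "l \<in> hom C B M" "m \<cdot> l = k"
    using factorsE[OF k m] .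
  show ?thesis
    using factorsI[OF comp_hom[OF h l(1)] m] comp_assoc[OF h l(1) m] l(2) by simp
qed

lemma factors_trans:
  assumes "factors C k m" "factors C m n" "k \<in> hom C B A" "m \<in> hom C M A" "n \<in> hom C N A"
  shows "factors C k n"
proof -
  obtain h where "h \<in> hom C B M" "m \<cdot> h = k"
    using factorsE[OF assms(1,3,4)] .
  then show ?thesis
    using factors_comp[OF assms(2,4,5)] by blast
qed

section \<open>Subobjects as equivalence classes, and their order\<close>

lemma mono_equiv_equiv: "equiv (monos_into C A) (mono_equiv C A)"
proof (rule equivI)
  show "mono_equiv C A \<subseteq> monos_into C A \<times> monos_into C A"
    by (auto simp: mono_equiv_def)
  show "refl_on (monos_into C A) (mono_equiv C A)"
    by (auto simp: refl_on_def mono_equiv_def dest: monos_into_hom intro: factors_refl)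
  show "sym (mono_equiv C A)"
    by (auto simp: sym_def mono_equiv_def)
  show "trans (mono_equiv C A)"
    unfolding trans_def mono_equiv_def by (auto; meson monos_into_hom factors_trans)
qed

lemma Sub_carrier: "carrier (Sub C A) = monos_into C A // mono_equiv C A"
  by (simp add: Sub_def)

lemma Sub_monos: "S \<in> carrier (Sub C A) \<Longrightarrow> m \<in> S \<Longrightarrow> m \<in> monos_into C A"
  using equiv_class_eq_iff[OF mono_equiv_equiv]
  by (auto simp: Sub_carrier quotient_def mono_equiv_def)

lemma Sub_nonempty: "S \<in> carrier (Sub C A) \<Longrightarrow> \<exists>m. m \<in> S"
  using in_quotient_imp_non_empty[OF mono_equiv_equiv] by (auto simp: Sub_carrier)

lemma Sub_equiv:
  assumes "S \<in> carrier (Sub C A)" "m \<in> S"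
  shows "n \<in> S \<longleftrightarrow> n \<in> monos_into C A \<and> factors C m n \<and> factors C n m"
proof -
  have "n \<in> S \<longleftrightarrow> (m, n) \<in> mono_equiv C A"
    using assms quotient_eq_iff[OF mono_equiv_equiv] in_quotient_imp_closed[OF mono_equiv_equiv]
      in_quotient_imp_in_rel[OF mono_equiv_equiv]
    by (metis Sub_carrier bot_least insert_subset)
  then show ?thesis
    using Sub_monos[OF assms] by (auto simp: mono_equiv_def)
qed

lemma Sub_hom: "S \<in> carrier (Sub C A) \<Longrightarrow> m \<in> S \<Longrightarrow> m \<in> hom C (Dom C m) A"
  by (rule monos_into_hom) (rule Sub_monos)

text \<open>Representatives of one class factor through each other, so the choice of representative
  does not affect membership.\<close>

lemma lies_in_iff:
  assumes S: "S \<in> carrier (Sub C A)" and m: "m \<in> S" and k: "k \<in> hom C B A"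
  shows "lies_in C k S \<longleftrightarrow> factors C k m"
proof
  assume "lies_in C k S"
  then obtain n where n: "n \<in> S" "factors C k n"
    by (auto simp: lies_in_def)
  then have "factors C n m"
    using Sub_equiv[OF S m, of n] by simp
  then show "factors C k m"
    by (rule factors_trans[OF n(2) _ k Sub_hom[OF S n(1)] Sub_hom[OF S m]])
next
  assume "factors C k m"
  then show "lies_in C k S"
    using m unfolding lies_in_def by (rule rev_bexI[rotated])
qed

text \<open>A Yoneda argument: two monomorphisms representing the same sieve factor through each
  other, as is seen by testing each of them as a generalized element. One representative therefore
  suffices for a whole class.\<close>

lemma sub_of_carrier:
  assumes "m \<in> sub_of C A P"
  shows "sub_of C A P \<in> carrier (Sub C A)"
proof -
  have mh: "m \<in> hom C (Dom C m) A"
    using assms by (rule sub_of_hom)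
  have "sub_of C A P = mono_equiv C A `` {m}"
  proof (intro Set.set_eqI iffI)
    fix n assume n: "n \<in> sub_of C A P"
    then have nh: "n \<in> hom C (Dom C n) A"
      by (rule sub_of_hom)
    have "factors C m n" "factors C n m"
      using sub_of_factors[OF assms mh] sub_of_factors[OF n mh] sub_of_factors[OF assms nh]
        sub_of_factors[OF n nh] factors_refl[OF mh] factors_refl[OF nh] by auto
    then show "n \<in> mono_equiv C A `` {m}"
      using assms n by (auto simp: mono_equiv_def sub_of_monos)
  next
    fix n assume "n \<in> mono_equiv C A `` {m}"
    then have n: "n \<in> monos_into C A" "factors C m n" "factors C n m"
      by (auto simp: mono_equiv_def)
    have "factors C k n \<longleftrightarrow> factors C k m" if "k \<in> hom C B A" for B k
      using factors_trans[OF _ n(2) that mh monos_into_hom[OF n(1)]]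
        factors_trans[OF _ n(3) that monos_into_hom[OF n(1)] mh] by blast
    then show "n \<in> sub_of C A P"
      using n(1) sub_of_factors[OF assms] by (intro sub_ofI) auto
  qed
  then show ?thesis
    using quotientI[OF sub_of_monos[OF assms]] by (simp add: Sub_carrier)
qed

lemma lies_in_sub_of:
  assumes "m \<in> sub_of C A P" "k \<in> hom C B A"
  shows "lies_in C k (sub_of C A P) \<longleftrightarrow> P k"
  using lies_in_iff[OF sub_of_carrier[OF assms(1)] assms] sub_of_factors[OF assms] by simp

text \<open>Every subobject is recovered from its generalized elements. This allows equality of
  subobjects to be proved by comparing memberships, as in \<open>Sub_eqI\<close>.\<close>

lemma Sub_eq_sub_of:
  assumes "S \<in> carrier (Sub C A)"
  shows "S = sub_of C A (\<lambda>k. lies_in C k S)"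
proof -
  obtain m where m: "m \<in> S"
    using assms Sub_nonempty by blast
  have mm: "m \<in> monos_into C A"
    using Sub_monos assms m .
  show ?thesis
  proof (intro Set.set_eqI iffI)
    fix n assume "n \<in> S"
    then show "n \<in> sub_of C A (\<lambda>k. lies_in C k S)"
      using lies_in_iff[OF assms] Sub_monos[OF assms] by (intro sub_ofI) auto
  next
    fix n assume n: "n \<in> sub_of C A (\<lambda>k. lies_in C k S)"
    then have nm: "n \<in> monos_into C A"
      by (rule sub_of_monos)
    show "n \<in> S"
      unfolding Sub_equiv[OF assms m]
      using nm sub_of_factors[OF n monos_into_hom[OF nm]] sub_of_factors[OF n monos_into_hom[OF mm]]
        lies_in_iff[OF assms m monos_into_hom[OF nm]] lies_in_iff[OF assms m monos_into_hom[OF mm]]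
        factors_refl[OF monos_into_hom[OF nm]] factors_refl[OF monos_into_hom[OF mm]] by auto
  qed
qed

text \<open>For the converse direction the generic element is tested: a representative
  \<open>m\<close> of \<open>S\<close> lies in \<open>S\<close>, hence in \<open>T\<close>.\<close>

lemma Sub_le_iff:
  assumes "S \<in> carrier (Sub C A)" "T \<in> carrier (Sub C A)"
  shows "S \<sqsubseteq>\<^bsub>Sub C A\<^esub> T \<longleftrightarrow> (\<forall>B. \<forall>k \<in> hom C B A. lies_in C k S \<longrightarrow> lies_in C k T)"
proof
  assume "S \<sqsubseteq>\<^bsub>Sub C A\<^esub> T"
  then obtain m n where "m \<in> S" "n \<in> T" "factors C m n"
    by (auto simp: Sub_def)
  then show "\<forall>B. \<forall>k \<in> hom C B A. lies_in C k S \<longrightarrow> lies_in C k T"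
    using lies_in_iff[OF assms(1), of m] lies_in_iff[OF assms(2), of n]
      Sub_hom[OF assms(1), of m] Sub_hom[OF assms(2), of n] factors_trans[of _ m n] by auto
next
  assume r: "\<forall>B. \<forall>k \<in> hom C B A. lies_in C k S \<longrightarrow> lies_in C k T"
  obtain m where m: "m \<in> S"
    using assms Sub_nonempty by blast
  then have "lies_in C m T"
    using r lies_in_iff[OF assms(1) m] Sub_hom[OF assms(1) m]
      factors_refl[OF Sub_hom[OF assms(1) m]] by auto
  then show "S \<sqsubseteq>\<^bsub>Sub C A\<^esub> T"
    using m by (auto simp: Sub_def lies_in_def)
qed

lemma Sub_eqI:
  assumes "S \<in> carrier (Sub C A)" "T \<in> carrier (Sub C A)"
    and "\<And>B k. k \<in> hom C B A \<Longrightarrow> lies_in C k S \<longleftrightarrow> lies_in C k T"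
  shows "S = T"
  using assms Sub_eq_sub_of sub_of_cong by metis

lemma Sub_partial_order: "partial_order (Sub C A)"
proof
  fix S T R
  show "S .=\<^bsub>Sub C A\<^esub> T \<Longrightarrow> T .=\<^bsub>Sub C A\<^esub> S" "S .=\<^bsub>Sub C A\<^esub> S"
    "(.=\<^bsub>Sub C A\<^esub>) = (=)"
    by (simp_all add: Sub_def)
  show "S .=\<^bsub>Sub C A\<^esub> T \<Longrightarrow> T .=\<^bsub>Sub C A\<^esub> R \<Longrightarrow> S .=\<^bsub>Sub C A\<^esub> R"
    by (simp add: Sub_def)
  show "S .=\<^bsub>Sub C A\<^esub> T" if "S \<sqsubseteq>\<^bsub>Sub C A\<^esub> T" "T \<sqsubseteq>\<^bsub>Sub C A\<^esub> S"
    "S \<in> carrier (Sub C A)" "T \<in> carrier (Sub C A)"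
  proof -
    have "S = T"
      using that by (intro Sub_eqI[of S A T]) (auto simp: Sub_le_iff)
    then show ?thesis by (simp add: Sub_def)
  qed
  show "S \<in> carrier (Sub C A) \<Longrightarrow> S \<sqsubseteq>\<^bsub>Sub C A\<^esub> S"
    by (simp add: Sub_le_iff)
  show "S \<sqsubseteq>\<^bsub>Sub C A\<^esub> R" if "S \<sqsubseteq>\<^bsub>Sub C A\<^esub> T" "T \<sqsubseteq>\<^bsub>Sub C A\<^esub> R"
    "S \<in> carrier (Sub C A)" "T \<in> carrier (Sub C A)" "R \<in> carrier (Sub C A)"
    using that by (simp add: Sub_le_iff)
  show "S \<sqsubseteq>\<^bsub>Sub C A\<^esub> R \<longleftrightarrow> T \<sqsubseteq>\<^bsub>Sub C A\<^esub> Q"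
    if "S .=\<^bsub>Sub C A\<^esub> T" "R .=\<^bsub>Sub C A\<^esub> Q" for Q
    using that by (simp add: Sub_def)
qed

text \<open>Since \<open>m\<close> is monic, the second leg of a pullback cone is determined by the
  first. The universal property thus reduces to a condition on the first leg alone, and this leg is
  again monic.\<close>

lemma pullback_mono_iff:
  assumes f: "f \<in> hom C A B" and m: "m \<in> monos_into C B"
  shows "(\<exists>q. is_pullback C f m n q) \<longleftrightarrow> n \<in> sub_of C A (\<lambda>k. factors C (f \<cdot> k) m)"
proof
  have m': "m \<in> hom C (Dom C m) B"
    using m by (rule monos_into_hom)
  {
    assume "\<exists>q. is_pullback C f m n q"
    then obtain q where q: "is_pullback C f m n q" by blast
    have n: "n \<in> hom C (Dom C n) A" and qh: "q \<in> hom C (Dom C n) (Dom C m)"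
      and eq: "f \<cdot> n = m \<cdot> q"
      using q homD[OF f] by (auto simp: is_pullback_def)
    have univ: "\<exists>!h. h \<in> hom C D (Dom C n) \<and> n \<cdot> h = a \<and> q \<cdot> h = b"
      if "a \<in> hom C D A" "b \<in> hom C D (Dom C m)" "f \<cdot> a = m \<cdot> b" for D a b
      using q that homD[OF f] unfolding is_pullback_def by metis
    have "is_mono C n"
      unfolding is_mono_def
    proof (intro conjI allI ballI impI)
      show "n \<in> Ar C" using n by (rule homD)
      fix D u v assume u: "u \<in> hom C D (Dom C n)" and v: "v \<in> hom C D (Dom C n)"
        and uv: "n \<cdot> u = n \<cdot> v"
      have "m \<cdot> (q \<cdot> u) = m \<cdot> (q \<cdot> v)"
        using comp_assoc[OF u qh m'] comp_assoc[OF v qh m'] comp_assoc[OF u n f]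
          comp_assoc[OF v n f] eq uv by simp
      then have "q \<cdot> u = q \<cdot> v"
        using monoD[OF monos_into_mono[OF m] comp_hom[OF u qh] comp_hom[OF v qh]] by simp
      moreover have "f \<cdot> (n \<cdot> u) = m \<cdot> (q \<cdot> u)"
        using comp_assoc[OF u qh m'] comp_assoc[OF u n f] eq by simp
      ultimately show "u = v"
        using univ[OF comp_hom[OF u n] comp_hom[OF u qh]] u v uv by metis
    qed
    then have nm: "n \<in> monos_into C A"
      using homD[OF n] by (simp add: monos_into_def)
    show "n \<in> sub_of C A (\<lambda>k. factors C (f \<cdot> k) m)"
    proof (rule sub_ofI[OF nm])
      fix D k assume k: "k \<in> hom C D A"
      show "factors C k n \<longleftrightarrow> factors C (f \<cdot> k) m"
      proof
        assume "factors C k n"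
        then obtain h where h: "h \<in> hom C D (Dom C n)" "n \<cdot> h = k"
          using factorsE k n by metis
        then have "f \<cdot> k = m \<cdot> (q \<cdot> h)"
          using comp_assoc[OF h(1) qh m'] comp_assoc[OF h(1) n f] eq by simp
        then show "factors C (f \<cdot> k) m"
          using factorsI comp_hom h(1) qh m' by metis
      next
        assume "factors C (f \<cdot> k) m"
        then obtain b where b: "b \<in> hom C D (Dom C m)" "f \<cdot> k = m \<cdot> b"
          using factorsE[OF _ comp_hom[OF k f] m'] by metis
        then show "factors C k n"
          using univ[OF k b] factorsI n by metis
      qed
    qed
  }
  {
    assume n: "n \<in> sub_of C A (\<lambda>k. factors C (f \<cdot> k) m)"
    then have nm: "n \<in> monos_into C A" and nh: "n \<in> hom C (Dom C n) A"
      by (rule sub_of_monos, rule sub_of_hom)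
    have "factors C (f \<cdot> n) m"
      using sub_of_factors[OF n nh] factors_refl[OF nh] by simp
    then obtain q where q: "q \<in> hom C (Dom C n) (Dom C m)" "m \<cdot> q = f \<cdot> n"
      using factorsE[OF _ comp_hom[OF nh f] m'] by metis
    have "is_pullback C f m n q"
      unfolding is_pullback_def
    proof (intro conjI allI ballI impI)
      fix D a b assume a: "a \<in> hom C D (Dom C f)" and b: "b \<in> hom C D (Dom C m)"
        and ab: "f \<cdot> a = m \<cdot> b"
      have a': "a \<in> hom C D A" using a homD[OF f] by simp
      have "factors C a n"
        using sub_of_factors[OF n a'] ab factorsI[OF b m'] by simp
      then obtain h where h: "h \<in> hom C D (Dom C n)" "n \<cdot> h = a"
        using factorsE a' nh by metis
      have "m \<cdot> (q \<cdot> h) = m \<cdot> b"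
        using comp_assoc[OF h(1) q(1) m'] comp_assoc[OF h(1) nh f] q(2) h(2) ab by simp
      then have "q \<cdot> h = b"
        using monoD[OF monos_into_mono[OF m] comp_hom[OF h(1) q(1)] b] by simp
      then show "\<exists>!h. h \<in> hom C D (Dom C n) \<and> n \<cdot> h = a \<and> q \<cdot> h = b"
        using h monoD[OF monos_into_mono[OF nm] h(1)] by metis
    qed (use homD[OF f] homD[OF q(1)] homD[OF m'] homD[OF nh] q nh in auto)
    then show "\<exists>q. is_pullback C f m n q" by blast
  }
qed

lemma sub_pullback_eq_sub_of:
  assumes f: "f \<in> hom C A B" and S: "S \<in> carrier (Sub C B)"
  shows "sub_pullback C f S = sub_of C A (\<lambda>k. lies_in C (f \<cdot> k) S)"
proof -
  have "sub_of C A (\<lambda>k. factors C (f \<cdot> k) m) = sub_of C A (\<lambda>k. lies_in C (f \<cdot> k) S)"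
    if "m \<in> S" for m
    by (rule sub_of_cong) (use comp_hom[OF _ f] lies_in_iff[OF S that] in metis)
  then show ?thesis
    using pullback_mono_iff[OF f] Sub_monos[OF S] Sub_nonempty[OF S]
    unfolding sub_pullback_def by auto
qed

text \<open>The universal property of an equalizer is rewritten as representation of a sieve;
  uniqueness of the factorization corresponds to \<open>e\<close> being monic.\<close>

lemma equalizer_iff:
  assumes f: "f \<in> hom C A B" and g: "g \<in> hom C A B"
  shows "is_equalizer C f g e \<longleftrightarrow> e \<in> sub_of C A (\<lambda>k. f \<cdot> k = g \<cdot> k)"
proof
  assume "is_equalizer C f g e"
  then have e: "e \<in> hom C (Dom C e) A" and eq: "f \<cdot> e = g \<cdot> e"
    and univ: "\<And>D d. d \<in> hom C D A \<Longrightarrow> f \<cdot> d = g \<cdot> d \<Longrightarrow>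
      \<exists>!h. h \<in> hom C D (Dom C e) \<and> e \<cdot> h = d"
    using homD[OF f] homD[OF g] unfolding is_equalizer_def by (simp_all add: hom_def)
  have eqh: "f \<cdot> (e \<cdot> h) = g \<cdot> (e \<cdot> h)" if "h \<in> hom C D (Dom C e)" for D h
    using comp_assoc[OF that e f] comp_assoc[OF that e g] eq by simp
  have "is_mono C e"
    unfolding is_mono_def
  proof (intro conjI allI ballI impI)
    fix D u v assume u: "u \<in> hom C D (Dom C e)" and v: "v \<in> hom C D (Dom C e)"
      and uv: "e \<cdot> u = e \<cdot> v"
    show "u = v"
      using univ[OF comp_hom[OF u e] eqh[OF u]] u v uv by metis
  qed (rule homD(1)[OF e])
  then have em: "e \<in> monos_into C A"
    using homD[OF e] by (simp add: monos_into_def)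
  show "e \<in> sub_of C A (\<lambda>k. f \<cdot> k = g \<cdot> k)"
  proof (rule sub_ofI[OF em])
    fix D k assume k: "k \<in> hom C D A"
    show "factors C k e \<longleftrightarrow> f \<cdot> k = g \<cdot> k"
    proof
      assume "factors C k e"
      then show "f \<cdot> k = g \<cdot> k"
        by (rule factorsE[OF _ k e]) (use eqh in auto)
    next
      assume "f \<cdot> k = g \<cdot> k"
      then obtain h where "h \<in> hom C D (Dom C e)" "e \<cdot> h = k"
        using univ[OF k] by auto
      then show "factors C k e"
        using factorsI[OF _ e] by auto
    qed
  qed
next
  assume e: "e \<in> sub_of C A (\<lambda>k. f \<cdot> k = g \<cdot> k)"
  then have em: "e \<in> monos_into C A" and eh: "e \<in> hom C (Dom C e) A"
    by (rule sub_of_monos, rule sub_of_hom)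
  have "f \<cdot> e = g \<cdot> e"
    using sub_of_factors[OF e eh] factors_refl[OF eh] by simp
  moreover have "\<exists>!h. h \<in> hom C D (Dom C e) \<and> e \<cdot> h = d"
    if d: "d \<in> hom C D A" "f \<cdot> d = g \<cdot> d" for D d
  proof -
    obtain h where "h \<in> hom C D (Dom C e)" "e \<cdot> h = d"
      using sub_of_factors[OF e d(1)] d(2) factorsE[OF _ d(1) eh] by auto
    then show ?thesis
      using monoD[OF monos_into_mono[OF em]] by auto
  qed
  ultimately show "is_equalizer C f g e"
    unfolding is_equalizer_def using f g eh by blast
qed

section \<open>The greatest subobject and infima\<close>

lemma id_mono: "A \<in> Ob C \<Longrightarrow> Idn C A \<in> sub_of C A (\<lambda>k. True)"
proof (rule sub_ofI)
  assume A: "A \<in> Ob C"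
  note i = id_hom[OF A]
  show "Idn C A \<in> monos_into C A"
    using homD[OF i] id_comp by (auto simp: monos_into_def is_mono_def)
  show "factors C k (Idn C A) \<longleftrightarrow> True" if "k \<in> hom C B A" for B k
    using factorsI[OF that i] id_comp[OF that] by simp
qed

text \<open>The greatest element is picked by a choice operator, so it is identified by showing that
  there is only one candidate.\<close>

lemma top_Sub:
  assumes "A \<in> Ob C"
  shows "\<top>\<^bsub>Sub C A\<^esub> = sub_of C A (\<lambda>k. True)"
proof -
  let ?T = "sub_of C A (\<lambda>k. True)"
  note T = sub_of_carrier[OF id_mono[OF assms]]
  have l: "lies_in C k ?T" if "k \<in> hom C B A" for k B
    using lies_in_sub_of[OF id_mono[OF assms] that] by simp
  have "greatest (Sub C A) ?T (carrier (Sub C A))"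
    unfolding greatest_def using T l by (auto simp: Sub_le_iff)
  moreover have "x = ?T" if "greatest (Sub C A) x (carrier (Sub C A))" for x
    using that T l unfolding greatest_def
    by (intro Sub_eqI[of x A]) (auto simp: Sub_le_iff)
  ultimately show ?thesis
    unfolding top_def by (metis someI)
qed

text \<open>As for the greatest element, uniqueness pins down the chosen infimum. That the
  intersection is representable is assumed here through \<open>m\<close>;
  \<open>finite_Inf_exists\<close> supplies it for finite families.\<close>

lemma Inf_Sub:
  assumes FA: "F \<subseteq> carrier (Sub C A)" and m: "m \<in> sub_of C A (\<lambda>k. \<forall>S \<in> F. lies_in C k S)"
  shows "\<Sqinter>\<^bsub>Sub C A\<^esub> F = sub_of C A (\<lambda>k. \<forall>S \<in> F. lies_in C k S)"
proof -
  let ?T = "sub_of C A (\<lambda>k. \<forall>S \<in> F. lies_in C k S)"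
  note T = sub_of_carrier[OF m] and l = lies_in_sub_of[OF m]
  have g: "greatest (Sub C A) ?T (Lower (Sub C A) F)"
    unfolding greatest_def Lower_def using T l FA by (auto simp: Sub_le_iff subset_iff)
  moreover have "x = ?T" if "greatest (Sub C A) x (Lower (Sub C A) F)" for x
    using that g Sub_partial_order[of A]
    by (meson greatest_def partial_order.le_antisym subsetD)
  ultimately show ?thesis
    unfolding inf_def by (metis someI)
qed

end

section \<open>Images in a regular category\<close>

text \<open>Membership in the image of \<open>S\<close> under \<open>f\<close>, described locally:
  after passing to a cover \<open>e\<close>, the element \<open>k\<close> is \<open>f\<close>
  applied to some element \<open>l\<close> of \<open>S\<close>.\<close>

definition image_pred :: "('o, 'a) cat \<Rightarrow> 'a \<Rightarrow> 'a set \<Rightarrow> 'a \<Rightarrow> bool" where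
  "image_pred C f S k \<longleftrightarrow> (\<exists>Z e l. regular_epi C e \<and> e \<in> hom C Z (Dom C k) \<and>
     l \<in> hom C Z (Dom C f) \<and> f \<cdot>\<^bsub>C\<^esub> l = k \<cdot>\<^bsub>C\<^esub> e \<and> lies_in C l S)"

section \<open>Regular epimorphisms as covers\<close>

context regular_category
begin

text \<open>Descent along a cover. The pair of which \<open>e\<close> is the coequalizer is itself
  identified by \<open>e\<close>, so \<open>kp\<close> applies to it; the pair need not be named by
  later users.\<close>

lemma regular_epi_factor:
  assumes re: "regular_epi C e" and e: "e \<in> hom C B A" and d: "d \<in> hom C B D"
    and kp: "\<And>Z u v. u \<in> hom C Z B \<Longrightarrow> v \<in> hom C Z B \<Longrightarrow> e \<cdot> u = e \<cdot> v \<Longrightarrow> d \<cdot> u = d \<cdot> v"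
  shows "\<exists>!h. h \<in> hom C A D \<and> h \<cdot> e = d"
proof -
  obtain f g where "is_coequalizer C f g e"
    using re by (auto simp: regular_epi_def)
  then obtain A' B' where *: "f \<in> hom C A' B'" "g \<in> hom C A' B'" "e \<in> hom C B' (Cod C e)"
    "e \<cdot> f = e \<cdot> g"
    "\<And>D d. d \<in> hom C B' D \<Longrightarrow> d \<cdot> f = d \<cdot> g \<Longrightarrow> \<exists>!h. h \<in> hom C (Cod C e) D \<and> h \<cdot> e = d"
    unfolding is_coequalizer_def by blast
  have "B' = B" "Cod C e = A"
    using homD[OF e] homD[OF *(3)] by auto
  then show ?thesis
    using *(5)[of d D] d kp[of f A' g] * by auto
qed

text \<open>Regular epimorphisms are epic: \<open>u\<close> and \<open>v\<close> are both the unique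
  factorization of \<open>u \<cdot> e\<close> through \<open>e\<close>.\<close>

lemma regular_epi_cancel:
  assumes re: "regular_epi C e" and e: "e \<in> hom C B A"
    and u: "u \<in> hom C A D" and v: "v \<in> hom C A D" and uv: "u \<cdot> e = v \<cdot> e"
  shows "u = v"
proof -
  have "\<exists>!h. h \<in> hom C A D \<and> h \<cdot> e = u \<cdot> e"
  proof (rule regular_epi_factor[OF re e comp_hom[OF e u]])
    fix Z a b assume a: "a \<in> hom C Z B" and b: "b \<in> hom C Z B" and ab: "e \<cdot> a = e \<cdot> b"
    show "(u \<cdot> e) \<cdot> a = (u \<cdot> e) \<cdot> b"
      using comp_assoc[OF a e u] comp_assoc[OF b e u] ab by simp
  qed
  then show ?thesis
    using u v uv by auto
qed

lemma id_regular_epi: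
  assumes A: "A \<in> Ob C"
  shows "regular_epi C (Idn C A)"
proof -
  note i = id_hom[OF A]
  have "\<exists>!h. h \<in> hom C A D \<and> h \<cdot> Idn C A = d" if "d \<in> hom C A D" for D d
    using comp_id that by metis
  then have "is_coequalizer C (Idn C A) (Idn C A) (Idn C A)"
    unfolding is_coequalizer_def homD(3)[OF i] using i by (intro exI[of _ A]) simp
  then show ?thesis
    unfolding regular_epi_def by blast
qed

lemma pullbackE:
  assumes "is_pullback C f g p q" "f \<in> hom C A D" "g \<in> hom C B D"
  obtains P where "p \<in> hom C P A" "q \<in> hom C P B" "f \<cdot> p = g \<cdot> q"
    "\<And>Z a b. a \<in> hom C Z A \<Longrightarrow> b \<in> hom C Z B \<Longrightarrow> f \<cdot> a = g \<cdot> b \<Longrightarrow>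
      \<exists>!h. h \<in> hom C Z P \<and> p \<cdot> h = a \<and> q \<cdot> h = b"
proof (rule that[of "Dom C p"])
  have d: "Dom C f = A" "Dom C g = B"
    using homD(2)[OF assms(2)] homD(2)[OF assms(3)] by auto
  show "p \<in> hom C (Dom C p) A" "q \<in> hom C (Dom C p) B" "f \<cdot> p = g \<cdot> q"
    using assms(1) d by (auto simp: is_pullback_def)
  show "\<exists>!h. h \<in> hom C Z (Dom C p) \<and> p \<cdot> h = a \<and> q \<cdot> h = b"
    if "a \<in> hom C Z A" "b \<in> hom C Z B" "f \<cdot> a = g \<cdot> b" for Z a b
    using assms(1) that unfolding is_pullback_def d by blast
qed

text \<open>Stability gives local lifting: any element \<open>k\<close> of the codomain of
  \<open>e\<close> lifts along \<open>e\<close> once its domain is replaced by a cover.\<close>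

lemma regular_epi_pullback:
  assumes re: "regular_epi C e" and e: "e \<in> hom C B A" and k: "k \<in> hom C Z A"
  obtains W e' k' where "regular_epi C e'" "e' \<in> hom C W Z" "k' \<in> hom C W B" "k \<cdot> e' = e \<cdot> k'"
proof -
  obtain p q where pq: "is_pullback C k e p q"
    using has_pullbacks[OF k e] by auto
  obtain P where "p \<in> hom C P Z" "q \<in> hom C P B" "k \<cdot> p = e \<cdot> q"
    by (rule pullbackE[OF pq k e])
  then show ?thesis
    using that regular_epi_stable[OF re pq] by auto
qed

text \<open>The cover \<open>e\<close> is the coequalizer of the kernel pair of \<open>f\<close>,
  and \<open>m\<close> is the induced arrow. To see that \<open>m\<close> is monic, two elements
  that it identifies are lifted to \<open>A\<close> on a common cover; the lifts agree under
  \<open>f\<close>, so \<open>e\<close> identifies them.\<close>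

lemma factorization:
  assumes f: "f \<in> hom C A B"
  obtains E e m where "regular_epi C e" "e \<in> hom C A E" "is_mono C m" "m \<in> hom C E B" "m \<cdot> e = f"
proof -
  obtain p q where pq: "is_pullback C f f p q"
    using has_pullbacks[OF f f] by auto
  obtain R where p: "p \<in> hom C R A" and q: "q \<in> hom C R A" and fpq: "f \<cdot> p = f \<cdot> q"
    and univ: "\<And>Z a b. a \<in> hom C Z A \<Longrightarrow> b \<in> hom C Z A \<Longrightarrow> f \<cdot> a = f \<cdot> b \<Longrightarrow>
      \<exists>!h. h \<in> hom C Z R \<and> p \<cdot> h = a \<and> q \<cdot> h = b"
    by (rule pullbackE[OF pq f f]) auto
  obtain e where ce: "is_coequalizer C p q e"
    using kernel_pair_coequalizer[OF pq] by auto
  then have re: "regular_epi C e"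
    by (auto simp: regular_epi_def)
  define E where "E = Cod C e"
  obtain R' A' where "p \<in> hom C R' A'" and e': "e \<in> hom C A' E" and epq: "e \<cdot> p = e \<cdot> q"
    and cuniv: "\<And>D d. d \<in> hom C A' D \<Longrightarrow> d \<cdot> p = d \<cdot> q \<Longrightarrow> \<exists>!h. h \<in> hom C E D \<and> h \<cdot> e = d"
    using ce unfolding is_coequalizer_def E_def by blast
  then have A': "A' = A"
    using homD[OF p] homD by metis
  have e: "e \<in> hom C A E"
    using e' A' by simp
  obtain m where m: "m \<in> hom C E B" and me: "m \<cdot> e = f"
    using cuniv[of f B] f fpq A' by auto
  have "is_mono C m"
    unfolding is_mono_def
  proof (intro conjI allI ballI impI)
    fix T u v assume "u \<in> hom C T (Dom C m)" "v \<in> hom C T (Dom C m)" and uv: "m \<cdot> u = m \<cdot> v"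
    then have u: "u \<in> hom C T E" and v: "v \<in> hom C T E"
      using homD[OF m] by auto
    obtain T1 t1 a where t1: "regular_epi C t1" "t1 \<in> hom C T1 T" and a: "a \<in> hom C T1 A"
      and ua: "u \<cdot> t1 = e \<cdot> a"
      by (rule regular_epi_pullback[OF re e u])
    note vt1 = comp_hom[OF t1(2) v]
    \<comment> \<open>The second element is lifted over the cover already used for the first, so
      that both lifts are available on \<open>T2\<close>.\<close>
    obtain T2 t2 b where t2: "regular_epi C t2" "t2 \<in> hom C T2 T1" and b: "b \<in> hom C T2 A"
      and vb: "(v \<cdot> t1) \<cdot> t2 = e \<cdot> b"
      by (rule regular_epi_pullback[OF re e vt1])
    note ut1 = comp_hom[OF t1(2) u]
    note a2 = comp_hom[OF t2(2) a]
    have ua2: "(u \<cdot> t1) \<cdot> t2 = e \<cdot> (a \<cdot> t2)"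
      using comp_assoc[OF t2(2) a e] ua by simp
    have "f \<cdot> (a \<cdot> t2) = m \<cdot> ((u \<cdot> t1) \<cdot> t2)"
      using comp_assoc[OF a2 e m] me ua2 by simp
    also have "\<dots> = (m \<cdot> u) \<cdot> (t1 \<cdot> t2)"
      using comp_assoc[OF t2(2) t1(2) u] comp_assoc[OF comp_hom[OF t2(2) t1(2)] u m] by simp
    also have "\<dots> = m \<cdot> ((v \<cdot> t1) \<cdot> t2)"
      using comp_assoc[OF t2(2) t1(2) v] comp_assoc[OF comp_hom[OF t2(2) t1(2)] v m] uv by simp
    also have "\<dots> = f \<cdot> b"
      using comp_assoc[OF b e m] me vb by simp
    \<comment> \<open>The two lifts have the same image under \<open>f\<close>, hence form an
      element \<open>h\<close> of the kernel pair.\<close>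
    finally obtain h where h: "h \<in> hom C T2 R" "p \<cdot> h = a \<cdot> t2" "q \<cdot> h = b"
      using univ[OF a2 b] by auto
    have "e \<cdot> (a \<cdot> t2) = e \<cdot> b"
      using comp_assoc[OF h(1) p e] comp_assoc[OF h(1) q e] epq h by simp
    then have "(u \<cdot> t1) \<cdot> t2 = (v \<cdot> t1) \<cdot> t2"
      using ua2 vb by simp
    then have "u \<cdot> t1 = v \<cdot> t1"
      by (rule regular_epi_cancel[OF t2 ut1 vt1])
    then show "u = v"
      by (rule regular_epi_cancel[OF t1 u v])
  qed (rule homD(1)[OF m])
  then show ?thesis
    using that re e m me by blast
qed

text \<open>Regular epimorphisms are orthogonal to monomorphisms: \<open>l\<close> respects all
  pairs identified by \<open>e\<close> because \<open>m\<close> can be cancelled, so it descends to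
  a diagonal \<open>d\<close>.\<close>

lemma mono_factors_cover:
  assumes re: "regular_epi C e" and e: "e \<in> hom C Z B" and m: "m \<in> monos_into C A"
    and k: "k \<in> hom C B A" and ke: "factors C (k \<cdot> e) m"
  shows "factors C k m"
proof -
  note mh = monos_into_hom[OF m]
  obtain l where l: "l \<in> hom C Z (Dom C m)" "m \<cdot> l = k \<cdot> e"
    by (rule factorsE[OF ke comp_hom[OF e k] mh])
  have "\<exists>!d. d \<in> hom C B (Dom C m) \<and> d \<cdot> e = l"
  proof (rule regular_epi_factor[OF re e l(1)])
    fix Y u v assume u: "u \<in> hom C Y Z" and v: "v \<in> hom C Y Z" and uv: "e \<cdot> u = e \<cdot> v"
    have "m \<cdot> (l \<cdot> u) = m \<cdot> (l \<cdot> v)"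
      using comp_assoc[OF u l(1) mh] comp_assoc[OF v l(1) mh] comp_assoc[OF u e k]
        comp_assoc[OF v e k] l(2) uv by simp
    then show "l \<cdot> u = l \<cdot> v"
      by (rule monoD[OF monos_into_mono[OF m] comp_hom[OF u l(1)] comp_hom[OF v l(1)]])
  qed
  then obtain d where d: "d \<in> hom C B (Dom C m)" "d \<cdot> e = l" by auto
  have md: "m \<cdot> d = k"
    by (rule regular_epi_cancel[OF re e comp_hom[OF d(1) mh] k])
      (use comp_assoc[OF e d(1) mh] d l in simp)
  then show ?thesis
    using factorsI[OF d(1) mh] by simp
qed

text \<open>Membership in a subobject is local: it can be checked after passing to a cover.\<close>

lemma lies_in_cover:
  assumes "regular_epi C e" "e \<in> hom C Z B" "S \<in> carrier (Sub C A)" "k \<in> hom C B A"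
    and "lies_in C (k \<cdot> e) S"
  shows "lies_in C k S"
proof -
  obtain m where "m \<in> S"
    using Sub_nonempty[OF assms(3)] by auto
  then show ?thesis
    using mono_factors_cover[OF assms(1,2) Sub_monos[OF assms(3)] assms(4)] assms(5)
      lies_in_iff[OF assms(3) _ assms(4)] lies_in_iff[OF assms(3) _ comp_hom[OF assms(2,4)]] by auto
qed

text \<open>The image is the monic part \<open>i\<close> of the factorization of
  \<open>f \<cdot> m\<close>, where \<open>m\<close> represents \<open>S\<close>. Elements of
  \<open>i\<close> lift locally along its cover part; conversely, a local factorization through
  \<open>i\<close> descends.\<close>

lemma image_exists:
  assumes f: "f \<in> hom C A B" and S: "S \<in> carrier (Sub C A)"
  shows "\<exists>i. i \<in> sub_of C B (image_pred C f S)"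
proof -
  obtain m where mS: "m \<in> S"
    using Sub_nonempty[OF S] by auto
  note m = Sub_hom[OF S mS] and fm = comp_hom[OF Sub_hom[OF S mS] f]
  obtain E e i where re: "regular_epi C e" and e: "e \<in> hom C (Dom C m) E" and im: "is_mono C i"
    and i: "i \<in> hom C E B" and ie: "i \<cdot> e = f \<cdot> m"
    by (rule factorization[OF fm])
  have im': "i \<in> monos_into C B"
    using im homD[OF i] by (simp add: monos_into_def)
  have "i \<in> sub_of C B (image_pred C f S)"
  proof (rule sub_ofI[OF im'])
    fix Y k assume k: "k \<in> hom C Y B"
    show "factors C k i \<longleftrightarrow> image_pred C f S k"
    proof
      assume "factors C k i"
      then obtain h where h: "h \<in> hom C Y E" "i \<cdot> h = k"
        using factorsE[OF _ k i] by metis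
      obtain W e' l where e': "regular_epi C e'" "e' \<in> hom C W Y" and l: "l \<in> hom C W (Dom C m)"
        and he: "h \<cdot> e' = e \<cdot> l"
        by (rule regular_epi_pullback[OF re e h(1)])
      have "f \<cdot> (m \<cdot> l) = k \<cdot> e'"
        using comp_assoc[OF l m f] ie comp_assoc[OF l e i] he comp_assoc[OF e'(2) h(1) i] h(2)
        by simp
      moreover have "lies_in C (m \<cdot> l) S"
        using lies_in_iff[OF S mS comp_hom[OF l m]] factorsI[OF l m] by simp
      ultimately show "image_pred C f S k"
        unfolding image_pred_def homD(2)[OF k] homD(2)[OF f]
        using e' comp_hom[OF l m] by blast
    next
      assume "image_pred C f S k"
      then obtain Z e' l where e': "regular_epi C e'" "e' \<in> hom C Z Y" and l: "l \<in> hom C Z A"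
        and fl: "f \<cdot> l = k \<cdot> e'" and lS: "lies_in C l S"
        unfolding image_pred_def homD(2)[OF k] homD(2)[OF f] by blast
      have "factors C l m"
        using lS lies_in_iff[OF S mS l] by simp
      then obtain h where h: "h \<in> hom C Z (Dom C m)" "m \<cdot> h = l"
        using factorsE[OF _ l m] by metis
      have "k \<cdot> e' = i \<cdot> (e \<cdot> h)"
        using fl h(2) comp_assoc[OF h(1) m f] ie comp_assoc[OF h(1) e i] by simp
      then have "factors C (k \<cdot> e') i"
        using factorsI[OF comp_hom[OF h(1) e] i] by simp
      then show "factors C k i"
        by (rule mono_factors_cover[OF e' im' k])
    qed
  qed
  then show ?thesis by blast
qed

section \<open>Pullback and image as operations on subobjects\<close>

lemma sub_of_pullback_exists:
  assumes f: "f \<in> hom C A B" and S: "S \<in> carrier (Sub C B)"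
  shows "\<exists>n. n \<in> sub_of C A (\<lambda>k. lies_in C (f \<cdot> k) S)"
proof -
  obtain m where m: "m \<in> S"
    using Sub_nonempty[OF S] by auto
  obtain n q where "is_pullback C f m n q"
    using has_pullbacks[OF f Sub_hom[OF S m]] by auto
  then have "n \<in> sub_pullback C f S"
    using m by (auto simp: sub_pullback_def)
  then show ?thesis
    using sub_pullback_eq_sub_of[OF f S] by auto
qed

lemma sub_pullback_carrier:
  assumes "f \<in> hom C A B" "S \<in> carrier (Sub C B)"
  shows "sub_pullback C f S \<in> carrier (Sub C A)"
  using sub_of_pullback_exists[OF assms] sub_of_carrier sub_pullback_eq_sub_of[OF assms] by auto

lemma lies_in_sub_pullback:
  assumes "f \<in> hom C A B" "S \<in> carrier (Sub C B)" "k \<in> hom C D A"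
  shows "lies_in C k (sub_pullback C f S) \<longleftrightarrow> lies_in C (f \<cdot> k) S"
  using sub_of_pullback_exists[OF assms(1,2)] lies_in_sub_of[OF _ assms(3)]
    sub_pullback_eq_sub_of[OF assms(1,2)] by auto

text \<open>This shows that the locally defined image has the adjunction by which
  \<open>sub_image\<close> is specified. One direction uses trivial covers, the other the local
  character of membership in \<open>T\<close>.\<close>

lemma image_adjoint:
  assumes f: "f \<in> hom C A B" and S: "S \<in> carrier (Sub C A)" and T: "T \<in> carrier (Sub C B)"
  shows "sub_of C B (image_pred C f S) \<sqsubseteq>\<^bsub>Sub C B\<^esub> T \<longleftrightarrow> S \<sqsubseteq>\<^bsub>Sub C A\<^esub> sub_pullback C f T"
proof -
  obtain i where i: "i \<in> sub_of C B (image_pred C f S)"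
    using image_exists[OF f S] by auto
  note le1 = Sub_le_iff[OF sub_of_carrier[OF i] T]
    and le2 = Sub_le_iff[OF S sub_pullback_carrier[OF f T]]
  show ?thesis
  proof
    assume a: "sub_of C B (image_pred C f S) \<sqsubseteq>\<^bsub>Sub C B\<^esub> T"
    show "S \<sqsubseteq>\<^bsub>Sub C A\<^esub> sub_pullback C f T"
      unfolding le2
    proof (intro allI ballI impI)
      fix D k assume k: "k \<in> hom C D A" and kS: "lies_in C k S"
      note fk = comp_hom[OF k f] and D = hom_ob(1)[OF k]
      \<comment> \<open>The identity of \<open>D\<close> serves as the cover and \<open>k\<close>
        itself as the lift.\<close>
      have "image_pred C f S (f \<cdot> k)"
        unfolding image_pred_def homD(2)[OF fk] homD(2)[OF f]
        using id_regular_epi[OF D] id_hom[OF D] k kS comp_id[OF fk] by metis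
      then show "lies_in C k (sub_pullback C f T)"
        using a fk lies_in_sub_of[OF i fk] lies_in_sub_pullback[OF f T k] unfolding le1 by auto
    qed
  next
    assume a: "S \<sqsubseteq>\<^bsub>Sub C A\<^esub> sub_pullback C f T"
    show "sub_of C B (image_pred C f S) \<sqsubseteq>\<^bsub>Sub C B\<^esub> T"
      unfolding le1
    proof (intro allI ballI impI)
      fix D k assume k: "k \<in> hom C D B" and "lies_in C k (sub_of C B (image_pred C f S))"
      then have "image_pred C f S k"
        using lies_in_sub_of[OF i k] by simp
      then obtain Z e l where e: "regular_epi C e" "e \<in> hom C Z D" and l: "l \<in> hom C Z A"
        and fl: "f \<cdot> l = k \<cdot> e" and lS: "lies_in C l S"
        unfolding image_pred_def homD(2)[OF k] homD(2)[OF f] by blast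
      have "lies_in C (f \<cdot> l) T"
        using a l lS lies_in_sub_pullback[OF f T l] unfolding le2 by auto
      then show "lies_in C k T"
        using lies_in_cover[OF e T k] fl by simp
    qed
  qed
qed

text \<open>\<open>sub_image\<close> is chosen among all lower adjoints of the pullback. The image
  just constructed shows that one exists, and antisymmetry determines its values on subobjects of
  \<open>A\<close>.\<close>

lemma sub_image_eq:
  assumes f: "f \<in> hom C A B" and S: "S \<in> carrier (Sub C A)"
  shows "sub_image C f S = sub_of C B (image_pred C f S)"
proof -
  let ?G = "\<lambda>e. \<lparr>orderA = Sub C (Dom C f), orderB = Sub C (Cod C f), lower = e,
    upper = sub_pullback C f\<rparr>"
  let ?e = "\<lambda>S. sub_of C B (image_pred C f S)"
  have car: "?e S \<in> carrier (Sub C B)" if "S \<in> carrier (Sub C A)" for S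
    using image_exists[OF f that] sub_of_carrier by auto
  have "galois_connection (?G ?e)"
    unfolding galois_connection_def connection_def galois_connection_axioms_def
    using homD[OF f] Sub_partial_order sub_pullback_carrier[OF f] image_adjoint[OF f] car
    by simp
  then have "galois_connection (?G (sub_image C f))"
    unfolding sub_image_def by (rule someI[where P = "\<lambda>e. galois_connection (?G e)"])
  then have g: "sub_image C f S \<in> carrier (Sub C B)"
    "\<And>T. T \<in> carrier (Sub C B) \<Longrightarrow>
      sub_image C f S \<sqsubseteq>\<^bsub>Sub C B\<^esub> T \<longleftrightarrow> S \<sqsubseteq>\<^bsub>Sub C A\<^esub> sub_pullback C f T"
    unfolding galois_connection_def connection_def galois_connection_axioms_def
    using homD[OF f] S by auto
  have iff: "sub_image C f S \<sqsubseteq>\<^bsub>Sub C B\<^esub> T \<longleftrightarrow> ?e S \<sqsubseteq>\<^bsub>Sub C B\<^esub> T"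
    if "T \<in> carrier (Sub C B)" for T
    using g(2)[OF that] image_adjoint[OF f S that] by simp
  \<comment> \<open>Each inequality is reflexivity transported through \<open>iff\<close>, with
    \<open>T\<close> taken to be either side in turn.\<close>
  have "sub_image C f S \<sqsubseteq>\<^bsub>Sub C B\<^esub> ?e S" "?e S \<sqsubseteq>\<^bsub>Sub C B\<^esub> sub_image C f S"
    using iff[OF car[OF S]] Sub_le_iff[OF car[OF S] car[OF S]] iff[OF g(1)]
      Sub_le_iff[OF g(1) g(1)] by simp_all
  then show ?thesis
    using g(1) car[OF S] by (intro partial_order.le_antisym[OF Sub_partial_order])
qed

lemma sub_image_carrier:
  assumes "f \<in> hom C A B" "S \<in> carrier (Sub C A)"
  shows "sub_image C f S \<in> carrier (Sub C B)"
  using image_exists[OF assms] sub_of_carrier sub_image_eq[OF assms] by auto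

lemma lies_in_sub_image:
  assumes f: "f \<in> hom C A B" and S: "S \<in> carrier (Sub C A)" and k: "k \<in> hom C D B"
  shows "lies_in C k (sub_image C f S) \<longleftrightarrow> (\<exists>Z e l. regular_epi C e \<and> e \<in> hom C Z D \<and>
     l \<in> hom C Z A \<and> f \<cdot> l = k \<cdot> e \<and> lies_in C l S)"
  using image_exists[OF f S] lies_in_sub_of[OF _ k, of _ "image_pred C f S"]
  unfolding sub_image_eq[OF f S] image_pred_def homD(2)[OF f] homD(2)[OF k] by auto

text \<open>Induction on the family. The new member is pulled back along the intersection
  \<open>m\<close> found so far and then pushed forward again by the image under
  \<open>m\<close>.\<close>

lemma finite_Inf_exists:
  assumes "finite F" "F \<subseteq> carrier (Sub C A)" "A \<in> Ob C"
  shows "\<exists>m. m \<in> sub_of C A (\<lambda>k. \<forall>S \<in> F. lies_in C k S)"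
  using assms(1,2)
proof induction
  case empty
  then show ?case using id_mono[OF assms(3)] by auto
next
  case (insert S F)
  then obtain m where m: "m \<in> sub_of C A (\<lambda>k. \<forall>S \<in> F. lies_in C k S)" by auto
  note mh = sub_of_hom[OF m] and S = insert.prems[THEN subsetD, OF insertI1]
  \<comment> \<open>The intersection of \<open>m\<close> and \<open>S\<close>.\<close>
  let ?T = "sub_image C m (sub_pullback C m S)"
  note p = sub_pullback_carrier[OF mh S]
  obtain i where i: "i \<in> ?T"
    using Sub_nonempty[OF sub_image_carrier[OF mh p]] by auto
  have T: "lies_in C k ?T \<longleftrightarrow> (\<forall>S \<in> insert S F. lies_in C k S)" if k: "k \<in> hom C B A" for B k
  proof
    assume "lies_in C k ?T"
    then obtain Z e l where e: "regular_epi C e" "e \<in> hom C Z B" and l: "l \<in> hom C Z (Dom C m)"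
      and ml: "m \<cdot> l = k \<cdot> e" and lS: "lies_in C l (sub_pullback C m S)"
      unfolding lies_in_sub_image[OF mh p k] by blast
    have "lies_in C (k \<cdot> e) S"
      using lS ml lies_in_sub_pullback[OF mh S l] by simp
    moreover have "factors C (k \<cdot> e) m"
      using factorsI[OF l mh] ml by simp
    ultimately show "\<forall>S \<in> insert S F. lies_in C k S"
      using lies_in_cover[OF e S k] mono_factors_cover[OF e sub_of_monos[OF m] k]
        sub_of_factors[OF m k] by auto
  next
    assume a: "\<forall>S \<in> insert S F. lies_in C k S"
    then have "factors C k m"
      using sub_of_factors[OF m k] by simp
    then obtain h where h: "h \<in> hom C B (Dom C m)" "m \<cdot> h = k"
      using factorsE[OF _ k mh] by metis
    note B = hom_ob(1)[OF k]
    have "lies_in C h (sub_pullback C m S)"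
      using a h lies_in_sub_pullback[OF mh S h(1)] by simp
    then show "lies_in C k ?T"
      unfolding lies_in_sub_image[OF mh p k]
      using id_regular_epi[OF B] id_hom[OF B] h comp_id[OF k] by metis
  qed
  have "?T = sub_of C A (\<lambda>k. lies_in C k ?T)"
    by (rule Sub_eq_sub_of[OF sub_image_carrier[OF mh p]])
  also have "\<dots> = sub_of C A (\<lambda>k. \<forall>S \<in> insert S F. lies_in C k S)"
    by (rule sub_of_cong) (rule T)
  finally show ?case
    using i by auto
qed

lemma
  assumes "finite F" "F \<subseteq> carrier (Sub C A)" "A \<in> Ob C"
  shows Inf_carrier: "\<Sqinter>\<^bsub>Sub C A\<^esub> F \<in> carrier (Sub C A)"
    and lies_in_Inf: "k \<in> hom C B A \<Longrightarrow>
      lies_in C k (\<Sqinter>\<^bsub>Sub C A\<^esub> F) \<longleftrightarrow> (\<forall>S \<in> F. lies_in C k S)"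
  using finite_Inf_exists[OF assms] Inf_Sub[OF assms(2)] sub_of_carrier lies_in_sub_of by fastforce+

end

section \<open>Finite limits\<close>

context regular_category
begin

text \<open>The product is a pullback over the terminal object, where the commutation condition on a
  cone holds automatically.\<close>

lemma binary_productE:
  assumes "A \<in> Ob C" "B \<in> Ob C"
  obtains Q p q where "p \<in> hom C Q A" "q \<in> hom C Q B"
    "\<And>Z a b. a \<in> hom C Z A \<Longrightarrow> b \<in> hom C Z B \<Longrightarrow> \<exists>!h. h \<in> hom C Z Q \<and> p \<cdot> h = a \<and> q \<cdot> h = b"
proof -
  obtain T where T: "\<And>A. A \<in> Ob C \<Longrightarrow> \<exists>!h. h \<in> hom C A T"
    using has_terminal unfolding is_terminal_def by metis
  obtain f g where f: "f \<in> hom C A T" and g: "g \<in> hom C B T"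
    using T assms by blast
  obtain p q where pq: "is_pullback C f g p q"
    using has_pullbacks[OF f g] by auto
  obtain Q where p: "p \<in> hom C Q A" and q: "q \<in> hom C Q B"
    and univ: "\<And>Z a b. a \<in> hom C Z A \<Longrightarrow> b \<in> hom C Z B \<Longrightarrow> f \<cdot> a = g \<cdot> b \<Longrightarrow>
      \<exists>!h. h \<in> hom C Z Q \<and> p \<cdot> h = a \<and> q \<cdot> h = b"
    by (rule pullbackE[OF pq f g]) auto
  show ?thesis
  proof (rule that[OF p q])
    fix Z a b assume a: "a \<in> hom C Z A" and b: "b \<in> hom C Z B"
    have "f \<cdot> a = g \<cdot> b"
      using T[OF hom_ob(1)[OF a]] comp_hom[OF a f] comp_hom[OF b g] by auto
    then show "\<exists>!h. h \<in> hom C Z Q \<and> p \<cdot> h = a \<and> q \<cdot> h = b"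
      by (rule univ[OF a b])
  qed
qed

text \<open>The terminal object is the empty product; a further factor \<open>D i\<close> is added
  by a binary product with \<open>P\<close>.\<close>

lemma product_exists:
  assumes "finite J" "D ` J \<subseteq> Ob C"
  shows "\<exists>P \<pi>. is_product C J D P \<pi>"
  using assms
proof induction
  case empty
  then show ?case
    using has_terminal by (auto simp: is_terminal_def is_product_def)
next
  case (insert i J)
  then obtain P \<pi> where "is_product C J D P \<pi>" by auto
  then have P: "P \<in> Ob C" and \<pi>: "\<And>j. j \<in> J \<Longrightarrow> \<pi> j \<in> hom C P (D j)"
    and univ: "\<And>A f. A \<in> Ob C \<Longrightarrow> (\<And>j. j \<in> J \<Longrightarrow> f j \<in> hom C A (D j)) \<Longrightarrow>
      \<exists>!h. h \<in> hom C A P \<and> (\<forall>j \<in> J. \<pi> j \<cdot> h = f j)"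
    unfolding is_product_def by blast+
  have Di: "D i \<in> Ob C"
    using insert.prems by simp
  obtain Q p q where p: "p \<in> hom C Q (D i)" and q: "q \<in> hom C Q P"
    and buniv: "\<And>Z a b. a \<in> hom C Z (D i) \<Longrightarrow> b \<in> hom C Z P \<Longrightarrow>
      \<exists>!h. h \<in> hom C Z Q \<and> p \<cdot> h = a \<and> q \<cdot> h = b"
    by (rule binary_productE[OF Di P]) blast
  let ?\<rho> = "\<lambda>j. if j = i then p else \<pi> j \<cdot> q"
  have "is_product C (insert i J) D Q ?\<rho>"
    unfolding is_product_def
  proof (intro conjI ballI allI impI)
    show "Q \<in> Ob C" using p by (rule hom_ob)
    show "?\<rho> j \<in> hom C Q (D j)" if "j \<in> insert i J" for j
      using that p comp_hom[OF q \<pi>] by auto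
    fix A f assume A: "A \<in> Ob C" and f: "\<forall>j \<in> insert i J. f j \<in> hom C A (D j)"
    have fi: "f i \<in> hom C A (D i)" using f by simp
    have "\<exists>!h. h \<in> hom C A P \<and> (\<forall>j \<in> J. \<pi> j \<cdot> h = f j)"
      by (rule univ[OF A]) (use f in simp)
    then obtain h where h: "h \<in> hom C A P" "\<forall>j \<in> J. \<pi> j \<cdot> h = f j"
      and h_unique: "\<forall>h'. h' \<in> hom C A P \<and> (\<forall>j \<in> J. \<pi> j \<cdot> h' = f j) \<longrightarrow> h' = h"
      unfolding Ex1_def by (elim exE conjE)
    obtain k where k: "k \<in> hom C A Q" "p \<cdot> k = f i" "q \<cdot> k = h"
      and k_unique: "\<forall>k'. k' \<in> hom C A Q \<and> p \<cdot> k' = f i \<and> q \<cdot> k' = h \<longrightarrow> k' = k"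
      using buniv[OF fi h(1)] unfolding Ex1_def by (elim exE conjE)
    show "\<exists>!k. k \<in> hom C A Q \<and> (\<forall>j \<in> insert i J. ?\<rho> j \<cdot> k = f j)"
    proof (rule ex1I[of _ k])
      have "?\<rho> j \<cdot> k = f j" if "j \<in> insert i J" for j
        using that k h(2) comp_assoc[OF k(1) q \<pi>[of j]] by auto
      then show "k \<in> hom C A Q \<and> (\<forall>j \<in> insert i J. ?\<rho> j \<cdot> k = f j)"
        using k(1) by blast
      fix k' assume k': "k' \<in> hom C A Q \<and> (\<forall>j \<in> insert i J. ?\<rho> j \<cdot> k' = f j)"
      have "\<pi> j \<cdot> (q \<cdot> k') = f j" if "j \<in> J" for j
      proof -
        have "j \<noteq> i" using that insert.hyps by auto
        then show ?thesis
          using that k' comp_assoc[OF _ q \<pi>[OF that], of k' A] by auto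
      qed
      then have "q \<cdot> k' = h"
        using h_unique comp_hom[OF k'[THEN conjunct1] q] by auto
      moreover have "p \<cdot> k' = f i"
        using k' by auto
      ultimately show "k' = k"
        using k_unique k' by blast
    qed
  qed
  then show ?case by blast
qed

section \<open>Chosen products and tuples\<close>

lemma is_product_product:
  assumes "finite J" "D ` J \<subseteq> Ob C"
  shows "is_product C J D (prod_obj C J D) (prod_proj C J D)"
proof -
  have "\<exists>x. case x of (P, \<pi>) \<Rightarrow> is_product C J D P \<pi>"
    using product_exists[OF assms] by auto
  from someI_ex[OF this] show ?thesis
    unfolding prod_obj_def prod_proj_def product_def by (simp add: case_prod_unfold)
qed

lemma prod_obj_ob:
  assumes "finite J" "D ` J \<subseteq> Ob C"
  shows "prod_obj C J D \<in> Ob C"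
  using is_product_product[OF assms] by (simp add: is_product_def)

lemma prod_proj_hom:
  assumes "finite J" "D ` J \<subseteq> Ob C" "i \<in> J"
  shows "prod_proj C J D i \<in> hom C (prod_obj C J D) (D i)"
  using is_product_product[OF assms(1,2)] assms(3) by (simp add: is_product_def)

lemma tuple:
  assumes J: "finite J" "D ` J \<subseteq> Ob C"
    and A: "A \<in> Ob C" and f: "\<forall>i \<in> J. f i \<in> hom C A (D i)"
  shows tuple_hom: "tuple C J D A f \<in> hom C A (prod_obj C J D)"
    and tuple_proj: "i \<in> J \<Longrightarrow> prod_proj C J D i \<cdot> tuple C J D A f = f i"
    and tuple_unique: "h \<in> hom C A (prod_obj C J D) \<Longrightarrow>
      \<forall>i \<in> J. prod_proj C J D i \<cdot> h = f i \<Longrightarrow> tuple C J D A f = h"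
proof -
  have ex: "\<exists>!h. h \<in> hom C A (prod_obj C J D) \<and> (\<forall>i \<in> J. prod_proj C J D i \<cdot> h = f i)"
    using is_product_product[of J D] J A f by (simp add: is_product_def)
  from theI'[OF ex] show "tuple C J D A f \<in> hom C A (prod_obj C J D)"
    "i \<in> J \<Longrightarrow> prod_proj C J D i \<cdot> tuple C J D A f = f i"
    unfolding tuple_def by auto
  show "tuple C J D A f = h" if "h \<in> hom C A (prod_obj C J D)"
    "\<forall>i \<in> J. prod_proj C J D i \<cdot> h = f i"
    unfolding tuple_def using the1_equality[OF ex] that by blast
qed

lemma prod_ext:
  assumes J: "finite J" "D ` J \<subseteq> Ob C"
    and u: "u \<in> hom C A (prod_obj C J D)" and v: "v \<in> hom C A (prod_obj C J D)"
    and uv: "\<forall>i \<in> J. prod_proj C J D i \<cdot> u = prod_proj C J D i \<cdot> v"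
  shows "u = v"
proof -
  have "\<forall>i \<in> J. prod_proj C J D i \<cdot> v \<in> hom C A (D i)"
    using comp_hom[OF v prod_proj_hom[OF J]] by auto
  note t = tuple_unique[OF J hom_ob(1)[OF u] this]
  show ?thesis
    using t[OF u uv] t[OF v] by simp
qed

text \<open>The equalizer is the pullback of the diagonal \<open>d\<close> of \<open>B\<close> along
  the pairing \<open>h\<close> of \<open>f\<close> and \<open>g\<close>: \<open>h \<cdot> k\<close>
  factors through the diagonal exactly when its two components agree.\<close>

lemma equalizer_exists:
  assumes f: "f \<in> hom C A B" and g: "g \<in> hom C A B"
  shows "\<exists>e. e \<in> sub_of C A (\<lambda>k. f \<cdot> k = g \<cdot> k)"
proof -
  note B = hom_ob(2)[OF f]
  note i = id_hom[OF B]
  obtain Q p q where p: "p \<in> hom C Q B" and q: "q \<in> hom C Q B"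
    and univ: "\<And>Z a b. a \<in> hom C Z B \<Longrightarrow> b \<in> hom C Z B \<Longrightarrow> \<exists>!h. h \<in> hom C Z Q \<and> p \<cdot> h = a \<and> q \<cdot> h = b"
    by (rule binary_productE[OF B B]) blast
  obtain d where d: "d \<in> hom C B Q" "p \<cdot> d = Idn C B" "q \<cdot> d = Idn C B"
    using univ[OF i i] by auto
  obtain h where h: "h \<in> hom C A Q" "p \<cdot> h = f" "q \<cdot> h = g"
    using univ[OF f g] by auto
  have pd: "p \<cdot> (d \<cdot> u) = u" "q \<cdot> (d \<cdot> u) = u" if "u \<in> hom C Z B" for u Z
    using comp_assoc[OF that d(1) p] comp_assoc[OF that d(1) q] d id_comp[OF that] by auto
  have "is_mono C d"
    unfolding is_mono_def homD(2)[OF d(1)]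
  proof (intro conjI allI ballI impI)
    fix Z u v assume "u \<in> hom C Z B" "v \<in> hom C Z B" "d \<cdot> u = d \<cdot> v"
    then show "u = v" using pd(1) by metis
  qed (rule homD(1)[OF d(1)])
  then have dm: "d \<in> monos_into C Q"
    using homD[OF d(1)] by (simp add: monos_into_def)
  obtain n r where "is_pullback C h d n r"
    using has_pullbacks[OF h(1) d(1)] by auto
  then have n: "n \<in> sub_of C A (\<lambda>k. factors C (h \<cdot> k) d)"
    using pullback_mono_iff[OF h(1) dm] by auto
  have "factors C (h \<cdot> k) d \<longleftrightarrow> f \<cdot> k = g \<cdot> k" if k: "k \<in> hom C Z A" for Z k
  proof -
    note hk = comp_hom[OF k h(1)]
    have ph: "p \<cdot> (h \<cdot> k) = f \<cdot> k" "q \<cdot> (h \<cdot> k) = g \<cdot> k"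
      using comp_assoc[OF k h(1) p] comp_assoc[OF k h(1) q] h by auto
    show ?thesis
    proof
      assume "factors C (h \<cdot> k) d"
      then obtain u where "u \<in> hom C Z B" "d \<cdot> u = h \<cdot> k"
        using factorsE[OF _ hk d(1)] by metis
      then show "f \<cdot> k = g \<cdot> k"
        using pd ph by metis
    next
      assume eq: "f \<cdot> k = g \<cdot> k"
      note fk = comp_hom[OF k f]
      have "d \<cdot> (f \<cdot> k) = h \<cdot> k"
        using univ[OF fk fk] pd[OF fk] ph comp_hom[OF fk d(1)] hk eq by metis
      then show "factors C (h \<cdot> k) d"
        using factorsI[OF fk d(1)] by simp
    qed
  qed
  then have "sub_of C A (\<lambda>k. factors C (h \<cdot> k) d) = sub_of C A (\<lambda>k. f \<cdot> k = g \<cdot> k)"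
    by (rule sub_of_cong)
  then show ?thesis
    using n by auto
qed

end


section \<open>Kripke--Joyal semantics\<close>

text \<open>
  A generalized element of a context with domain \<open>A\<close> is given by its components, a family \<open>a\<close> of
  arrows from \<open>A\<close>. The family is indexed by all variables; its values outside the context are
  junk, so that no context has to be recorded.
\<close>

primrec tm_val ::
  "('o, 'a) cat \<Rightarrow> ('s, 'f, 'r, 'v) lang \<Rightarrow> ('o, 'a, 's, 'f, 'r) interp \<Rightarrow> 'o \<Rightarrow> ('v \<Rightarrow> 'a) \<Rightarrow>
     ('f, 'v) tm \<Rightarrow> 'a" where
  "tm_val C L I A a (Var x) = a x"
| "tm_val C L I A a (Fn f ts) =
     fn_arr I f \<cdot>\<^bsub>C\<^esub> args_tuple C I (fn_args L f) A (map (tm_val C L I A a) ts)"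

text \<open>In the clause for \<open>Ex\<close> the witness \<open>b\<close> exists only on a cover
  \<open>e\<close>, to which the other components are restricted. The update at \<open>x\<close>
  treats a shadowed and a new variable alike, so no case split on the context occurs, in contrast to
  \<open>fm_sub\<close>.\<close>

primrec forces ::
  "('o, 'a) cat \<Rightarrow> ('s, 'f, 'r, 'v) lang \<Rightarrow> ('o, 'a, 's, 'f, 'r) interp \<Rightarrow>
     ('f, 'r, 'v) fm \<Rightarrow> 'o \<Rightarrow> ('v \<Rightarrow> 'a) \<Rightarrow> bool" where
  "forces C L I (Rel r ts) A a \<longleftrightarrow>
     lies_in C (args_tuple C I (rel_args L r) A (map (tm_val C L I A a) ts)) (rel_sub I r)"
| "forces C L I (Equal s t) A a \<longleftrightarrow> tm_val C L I A a s = tm_val C L I A a t"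
| "forces C L I Truth A a \<longleftrightarrow> True"
| "forces C L I (And \<phi> \<psi>) A a \<longleftrightarrow> forces C L I \<phi> A a \<and> forces C L I \<psi> A a"
| "forces C L I (Ex x \<phi>) A a \<longleftrightarrow>
     (\<exists>Z e b. regular_epi C e \<and> e \<in> hom C Z A \<and> b \<in> hom C Z (ty_obj I (var_type L x)) \<and>
        forces C L I \<phi> Z ((\<lambda>y. a y \<cdot>\<^bsub>C\<^esub> e)(x := b)))"

lemma tm_val_cong:
  "(\<And>y. y \<in> tm_vars t \<Longrightarrow> a y = b y) \<Longrightarrow> tm_val C L I A a t = tm_val C L I A b t"
proof (induction t)
  case (Fn f ts)
  then have "map (tm_val C L I A a) ts = map (tm_val C L I A b) ts" by auto
  then show ?case by (simp only: tm_val.simps)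
qed simp

text \<open>This makes the interpretation insensitive to the context. For \<open>Ex\<close>, any
  difference at the bound variable is erased by the update.\<close>

lemma forces_cong:
  "(\<And>y. y \<in> free_vars \<phi> \<Longrightarrow> a y = b y) \<Longrightarrow> forces C L I \<phi> A a \<longleftrightarrow> forces C L I \<phi> A b"
proof (induction \<phi> arbitrary: A a b)
  case (Rel r ts)
  then have "map (tm_val C L I A a) ts = map (tm_val C L I A b) ts"
    by (auto intro!: tm_val_cong)
  then show ?case by (simp only: forces.simps)
next
  case (Equal s t)
  then show ?case
    using tm_val_cong[of s a b C L I A] tm_val_cong[of t a b C L I A] by simp
next
  case (And \<phi> \<psi>)
  then show ?case by (metis UnCI forces.simps(4) free_vars.simps(4))
next
  case (Ex x \<phi>)
  have "forces C L I \<phi> Z ((\<lambda>y. a y \<cdot>\<^bsub>C\<^esub> e)(x := c)) \<longleftrightarrow>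
      forces C L I \<phi> Z ((\<lambda>y. b y \<cdot>\<^bsub>C\<^esub> e)(x := c))" for Z e c
    by (rule Ex.IH) (use Ex.prems in auto)
  then show ?case by simp
qed simp

section \<open>Contexts, terms and formulas under an interpretation\<close>

locale regular_interp = regular_category C for C :: "('o, 'a) cat" (structure) +
  fixes L :: "('s, 'f, 'r, 'v) lang" and I :: "('o, 'a, 's, 'f, 'r) interp"
  assumes interp: "is_interp C L I"
begin

lemma ty_obj_ob: "ty_obj I T \<in> Ob C"
  using interp by (simp add: is_interp_def)

lemma ty_objs_ob: "(\<lambda>i. ty_obj I (T i)) ` J \<subseteq> Ob C"
  using ty_obj_ob by auto

lemma fn_arr_hom: "fn_arr I f \<in> hom C (args_prod C I (fn_args L f)) (ty_obj I (fn_res L f))"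
  using interp by (simp add: is_interp_def)

lemma rel_sub_carrier: "rel_sub I r \<in> carrier (Sub C (args_prod C I (rel_args L r)))"
  using interp by (simp add: is_interp_def)

lemma ctx_ob: "finite U \<Longrightarrow> ctx C L I U \<in> Ob C"
  unfolding ctx_def by (rule prod_obj_ob[OF _ ty_objs_ob])

lemma ctx_var_hom:
  "finite U \<Longrightarrow> x \<in> U \<Longrightarrow> ctx_var C L I U x \<in> hom C (ctx C L I U) (ty_obj I (var_type L x))"
  unfolding ctx_def ctx_var_def
  by (rule prod_proj_hom[OF _ ty_objs_ob])

lemma ctx_ext:
  assumes "finite U" "u \<in> hom C A (ctx C L I U)" "v \<in> hom C A (ctx C L I U)"
    and "\<And>x. x \<in> U \<Longrightarrow> ctx_var C L I U x \<cdot> u = ctx_var C L I U x \<cdot> v"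
  shows "u = v"
  using assms unfolding ctx_def ctx_var_def
  by (intro prod_ext[OF assms(1) ty_objs_ob[of _ U]]) auto

lemma ctx_tupleE:
  assumes "finite U" "A \<in> Ob C" "\<forall>x \<in> U. a x \<in> hom C A (ty_obj I (var_type L x))"
  obtains l where "l \<in> hom C A (ctx C L I U)" "\<And>x. x \<in> U \<Longrightarrow> ctx_var C L I U x \<cdot> l = a x"
proof
  let ?l = "tuple C U (\<lambda>x. ty_obj I (var_type L x)) A a"
  show "?l \<in> hom C A (ctx C L I U)"
    unfolding ctx_def by (rule tuple_hom[OF assms(1) ty_objs_ob assms(2,3)])
  show "ctx_var C L I U x \<cdot> ?l = a x" if "x \<in> U" for x
    unfolding ctx_var_def by (rule tuple_proj[OF assms(1) ty_objs_ob assms(2,3) that])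
qed

lemma ctx_proj:
  assumes "U \<subseteq> V" "finite V"
  shows ctx_proj_hom: "ctx_proj C L I U V \<in> hom C (ctx C L I V) (ctx C L I U)"
    and ctx_var_proj: "x \<in> U \<Longrightarrow> ctx_var C L I U x \<cdot> ctx_proj C L I U V = ctx_var C L I V x"
proof -
  note fU = finite_subset[OF assms]
  have v: "\<forall>x \<in> U. ctx_var C L I V x \<in> hom C (ctx C L I V) (ty_obj I (var_type L x))"
    using ctx_var_hom[OF assms(2)] assms(1) by auto
  show "ctx_proj C L I U V \<in> hom C (ctx C L I V) (ctx C L I U)"
    unfolding ctx_proj_def ctx_def[of C L I U]
    by (rule tuple_hom[OF fU ty_objs_ob ctx_ob[OF assms(2)] v])
  show "ctx_var C L I U x \<cdot> ctx_proj C L I U V = ctx_var C L I V x" if "x \<in> U"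
    unfolding ctx_proj_def ctx_var_def[of C L I U]
    by (rule tuple_proj[OF fU ty_objs_ob ctx_ob[OF assms(2)] v that])
qed

lemma ctx_var_proj_comp:
  assumes "U \<subseteq> V" "finite V" "k \<in> hom C A (ctx C L I V)" "x \<in> U"
  shows "ctx_var C L I U x \<cdot> (ctx_proj C L I U V \<cdot> k) = ctx_var C L I V x \<cdot> k"
  using comp_assoc[OF assms(3) ctx_proj_hom[OF assms(1,2)]
      ctx_var_hom[OF finite_subset[OF assms(1,2)] assms(4)]]
    ctx_var_proj[OF assms(1,2,4)] by simp

lemma args_tuple_hom:
  assumes "A \<in> Ob C" "list_all2 (\<lambda>f T. f \<in> hom C A (ty_obj I T)) fs Ts"
  shows "args_tuple C I Ts A fs \<in> hom C A (args_prod C I Ts)"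
  unfolding args_tuple_def args_prod_def
  using assms by (intro tuple_hom) (auto simp: ty_obj_ob list_all2_conv_all_nth)

text \<open>Both arrows have the same components, so uniqueness of tuples applies.\<close>

lemma args_tuple_comp:
  assumes fs: "list_all2 (\<lambda>f T. f \<in> hom C A (ty_obj I T)) fs Ts" and k: "k \<in> hom C B A"
  shows "args_tuple C I Ts A fs \<cdot> k = args_tuple C I Ts B (map (\<lambda>f. f \<cdot> k) fs)"
proof -
  let ?D = "\<lambda>i. ty_obj I (Ts ! i)" and ?J = "{..<length Ts}"
  note A = hom_ob(2)[OF k] and B = hom_ob(1)[OF k]
  have fs': "\<forall>i \<in> ?J. fs ! i \<in> hom C A (?D i)"
    using fs by (auto simp: list_all2_conv_all_nth)
  have len: "length fs = length Ts"
    using fs by (rule list_all2_lengthD)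
  have fk: "\<forall>i \<in> ?J. map (\<lambda>f. f \<cdot> k) fs ! i \<in> hom C B (?D i)"
    using comp_hom[OF k] fs' len by simp
  note t = tuple_hom[OF finite_lessThan ty_objs_ob A fs']
  have "prod_proj C ?J ?D i \<cdot> (tuple C ?J ?D A (\<lambda>i. fs ! i) \<cdot> k) = map (\<lambda>f. f \<cdot> k) fs ! i"
    if i: "i \<in> ?J" for i
    using comp_assoc[OF k t prod_proj_hom[OF finite_lessThan ty_objs_ob[of "\<lambda>i. Ts ! i"] i]]
      tuple_proj[OF finite_lessThan ty_objs_ob A fs' i] len i by simp
  then show ?thesis
    unfolding args_tuple_def
    by (intro tuple_unique[OF finite_lessThan ty_objs_ob B fk comp_hom[OF k t], symmetric]) blast
qed

text \<open>Typing and evaluation are proved in one induction; the evaluation step for a function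
  symbol needs the typing of its arguments in order to reassociate and to compose tuples.\<close>

lemma tm_arr_sound:
  assumes "has_type L t T" "finite U" "tm_vars t \<subseteq> U"
  shows "tm_arr C L I U t \<in> hom C (ctx C L I U) (ty_obj I T) \<and>
    (\<forall>A. \<forall>k \<in> hom C A (ctx C L I U).
       tm_arr C L I U t \<cdot> k = tm_val C L I A (\<lambda>y. ctx_var C L I U y \<cdot> k) t)"
  using assms
proof (induction rule: has_type.induct)
  case (1 x)
  then show ?case using ctx_var_hom by simp
next
  case (2 ts f)
  let ?fs = "map (tm_arr C L I U) ts"
  have len: "length ts = length (fn_args L f)"
    using "2.IH" by (rule list_all2_lengthD)
  have IH: "tm_arr C L I U (ts ! i) \<in> hom C (ctx C L I U) (ty_obj I (fn_args L f ! i))"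
    "\<And>A k. k \<in> hom C A (ctx C L I U) \<Longrightarrow>
       tm_arr C L I U (ts ! i) \<cdot> k = tm_val C L I A (\<lambda>y. ctx_var C L I U y \<cdot> k) (ts ! i)"
    if "i < length ts" for i
    using list_all2_nthD[OF "2.IH" that] "2.prems" nth_mem[OF that] by auto
  have fs: "list_all2 (\<lambda>g T. g \<in> hom C (ctx C L I U) (ty_obj I T)) ?fs (fn_args L f)"
    using IH(1) len by (simp add: list_all2_conv_all_nth)
  note t = args_tuple_hom[OF ctx_ob[OF "2.prems"(1)] fs]
  show ?case
  proof (intro conjI allI ballI)
    show "tm_arr C L I U (Fn f ts) \<in> hom C (ctx C L I U) (ty_obj I (fn_res L f))"
      using comp_hom[OF t fn_arr_hom] by simp
    fix A k assume k: "k \<in> hom C A (ctx C L I U)"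
    have m: "map (\<lambda>g. g \<cdot> k) ?fs = map (tm_val C L I A (\<lambda>y. ctx_var C L I U y \<cdot> k)) ts"
      using IH(2)[OF _ k] by (intro nth_equalityI) auto
    show "tm_arr C L I U (Fn f ts) \<cdot> k = tm_val C L I A (\<lambda>y. ctx_var C L I U y \<cdot> k) (Fn f ts)"
      using comp_assoc[OF k t fn_arr_hom] args_tuple_comp[OF fs k] unfolding m by simp
  qed
qed

text \<open>An element of the extended context over \<open>j \<cdot> e\<close> amounts to a single
  new component at \<open>x\<close>. The local description of images thereby becomes the forcing
  clause for \<open>Ex\<close>.\<close>

lemma sub_image_forces:
  assumes fin: "finite U" and x: "x \<notin> U"
    and S: "S \<in> carrier (Sub C (ctx C L I (insert x U)))"
    and fS: "\<And>A k. k \<in> hom C A (ctx C L I (insert x U)) \<Longrightarrow>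
      lies_in C k S \<longleftrightarrow> forces C L I \<phi> A (\<lambda>y. ctx_var C L I (insert x U) y \<cdot> k)"
    and fv: "free_vars \<phi> \<subseteq> insert x U" and j: "j \<in> hom C A (ctx C L I U)"
  shows "lies_in C j (sub_image C (ctx_proj C L I U (insert x U)) S) \<longleftrightarrow>
    forces C L I (Ex x \<phi>) A (\<lambda>y. ctx_var C L I U y \<cdot> j)"
proof -
  let ?V = "insert x U" and ?p = "ctx_proj C L I U (insert x U)"
  have V: "U \<subseteq> ?V" "finite ?V" "x \<in> ?V"
    using fin by auto
  note p = ctx_proj_hom[OF V(1,2)]
  note vj = comp_assoc[OF _ j ctx_var_hom[OF fin]]
  show ?thesis
    unfolding lies_in_sub_image[OF p S j] forces.simps
  proof (intro iffI; elim exE conjE)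
    fix Z e l assume e: "regular_epi C e" "e \<in> hom C Z A" and l: "l \<in> hom C Z (ctx C L I ?V)"
      and pl: "?p \<cdot> l = j \<cdot> e" and "lies_in C l S"
    then have f: "forces C L I \<phi> Z (\<lambda>y. ctx_var C L I ?V y \<cdot> l)"
      using fS by simp
    \<comment> \<open>The witness is the component of the lift \<open>l\<close> at the new
      variable.\<close>
    let ?b = "ctx_var C L I ?V x \<cdot> l"
    have "forces C L I \<phi> Z ((\<lambda>y. (ctx_var C L I U y \<cdot> j) \<cdot> e)(x := ?b))"
    proof (rule forces_cong[THEN iffD1, OF _ f])
      fix y assume "y \<in> free_vars \<phi>"
      then show "ctx_var C L I ?V y \<cdot> l = ((\<lambda>y. (ctx_var C L I U y \<cdot> j) \<cdot> e)(x := ?b)) y"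
        using fv ctx_var_proj_comp[OF V(1,2) l] pl vj[OF e(2)] by auto
    qed
    then show "\<exists>Z e b. regular_epi C e \<and> e \<in> hom C Z A \<and> b \<in> hom C Z (ty_obj I (var_type L x)) \<and>
        forces C L I \<phi> Z ((\<lambda>y. (ctx_var C L I U y \<cdot> j) \<cdot> e)(x := b))"
      using e comp_hom[OF l ctx_var_hom[OF V(2,3)]] by blast
  next
    fix Z e b assume e: "regular_epi C e" "e \<in> hom C Z A"
      and b: "b \<in> hom C Z (ty_obj I (var_type L x))"
      and f: "forces C L I \<phi> Z ((\<lambda>y. (ctx_var C L I U y \<cdot> j) \<cdot> e)(x := b))"
    let ?a = "(\<lambda>y. (ctx_var C L I U y \<cdot> j) \<cdot> e)(x := b)"
    note je = comp_hom[OF e(2) j]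
    have "\<forall>y \<in> ?V. ?a y \<in> hom C Z (ty_obj I (var_type L y))"
      using b comp_hom[OF e(2) comp_hom[OF j ctx_var_hom[OF fin]]] by auto
    then obtain l where l: "l \<in> hom C Z (ctx C L I ?V)" "\<And>y. y \<in> ?V \<Longrightarrow> ctx_var C L I ?V y \<cdot> l = ?a y"
      by (rule ctx_tupleE[OF V(2) hom_ob(1)[OF b]]) blast
    \<comment> \<open>The comparison is made by components over \<open>U\<close>; as
      \<open>x\<close> is not in \<open>U\<close>, the updated value plays no part in it.\<close>
    have "?p \<cdot> l = j \<cdot> e"
    proof (rule ctx_ext[OF fin comp_hom[OF l(1) p] je])
      fix y assume y: "y \<in> U"
      then show "ctx_var C L I U y \<cdot> (?p \<cdot> l) = ctx_var C L I U y \<cdot> (j \<cdot> e)"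
        using ctx_var_proj_comp[OF V(1,2) l(1) y] l(2)[of y] vj[OF e(2) y] x by auto
    qed
    moreover have "lies_in C l S"
      unfolding fS[OF l(1)]
      by (rule forces_cong[THEN iffD1, OF _ f]) (use fv l(2) in \<open>auto simp del: fun_upd_apply\<close>)
    ultimately show "\<exists>Z e l. regular_epi C e \<and> e \<in> hom C Z A \<and> l \<in> hom C Z (ctx C L I ?V) \<and>
        ?p \<cdot> l = j \<cdot> e \<and> lies_in C l S"
      using e l(1) by blast
  qed
qed

text \<open>The bridge between the categorical interpretation and forcing. The context is
  generalized in the induction because \<open>Ex\<close> evaluates its body over
  \<open>insert x U\<close>; well-definedness is carried along since the membership lemmas require
  genuine subobjects.\<close>

lemma fm_sub_sound:
  assumes "wf_fm L \<phi>" "finite U" "free_vars \<phi> \<subseteq> U"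
  shows "fm_sub C L I \<phi> U \<in> carrier (Sub C (ctx C L I U)) \<and>
    (\<forall>A. \<forall>k \<in> hom C A (ctx C L I U).
       lies_in C k (fm_sub C L I \<phi> U) \<longleftrightarrow> forces C L I \<phi> A (\<lambda>y. ctx_var C L I U y \<cdot> k))"
  using assms
proof (induction \<phi> arbitrary: U)
  case (Rel r ts)
  let ?fs = "map (tm_arr C L I U) ts"
  have wt: "list_all2 (has_type L) ts (rel_args L r)"
    using Rel.prems by simp
  note len = list_all2_lengthD[OF wt]
  have ts: "tm_arr C L I U (ts ! i) \<in> hom C (ctx C L I U) (ty_obj I (rel_args L r ! i))"
    "\<And>A k. k \<in> hom C A (ctx C L I U) \<Longrightarrow>
       tm_arr C L I U (ts ! i) \<cdot> k = tm_val C L I A (\<lambda>y. ctx_var C L I U y \<cdot> k) (ts ! i)"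
    if "i < length ts" for i
    using tm_arr_sound[OF list_all2_nthD[OF wt that] Rel.prems(2)] Rel.prems(3) nth_mem[OF that]
    by auto
  have fs: "list_all2 (\<lambda>g T. g \<in> hom C (ctx C L I U) (ty_obj I T)) ?fs (rel_args L r)"
    using ts(1) len by (simp add: list_all2_conv_all_nth)
  note t = args_tuple_hom[OF ctx_ob[OF Rel.prems(2)] fs]
  have "lies_in C k (fm_sub C L I (Rel r ts) U) \<longleftrightarrow>
      forces C L I (Rel r ts) A (\<lambda>y. ctx_var C L I U y \<cdot> k)"
    if k: "k \<in> hom C A (ctx C L I U)" for A k
  proof -
    have m: "map (\<lambda>g. g \<cdot> k) ?fs = map (tm_val C L I A (\<lambda>y. ctx_var C L I U y \<cdot> k)) ts"
      using ts(2)[OF _ k] by (intro nth_equalityI) auto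
    show ?thesis
      using lies_in_sub_pullback[OF t rel_sub_carrier k] args_tuple_comp[OF fs k]
      unfolding m by simp
  qed
  then show ?case
    using sub_pullback_carrier[OF t rel_sub_carrier] by simp
next
  case (Equal s t)
  then obtain T where T: "has_type L s T" "has_type L t T" by auto
  have vars: "tm_vars s \<subseteq> U" "tm_vars t \<subseteq> U"
    using Equal.prems by auto
  note s = tm_arr_sound[OF T(1) Equal.prems(2) vars(1)]
    and t = tm_arr_sound[OF T(2) Equal.prems(2) vars(2)]
  note s1 = s[THEN conjunct1] and t1 = t[THEN conjunct1]
  obtain e where e: "e \<in> sub_of C (ctx C L I U)
      (\<lambda>k. tm_arr C L I U s \<cdot> k = tm_arr C L I U t \<cdot> k)"
    using equalizer_exists[OF s1 t1] by auto
  have "fm_sub C L I (Equal s t) U = sub_of C (ctx C L I U)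
      (\<lambda>k. tm_arr C L I U s \<cdot> k = tm_arr C L I U t \<cdot> k)"
    using equalizer_iff[OF s1 t1] by auto
  then show ?case
    using sub_of_carrier[OF e] lies_in_sub_of[OF e] s t by simp
next
  case Truth
  note U = ctx_ob[OF Truth.prems(2)]
  then show ?case
    using top_Sub[OF U] sub_of_carrier[OF id_mono[OF U]] lies_in_sub_of[OF id_mono[OF U]] by simp
next
  case (And \<phi> \<psi>)
  note U = ctx_ob[OF And.prems(2)]
  have IH: "fm_sub C L I \<phi> U \<in> carrier (Sub C (ctx C L I U))"
    "fm_sub C L I \<psi> U \<in> carrier (Sub C (ctx C L I U))"
    and f: "\<And>A k. k \<in> hom C A (ctx C L I U) \<Longrightarrow>
       lies_in C k (fm_sub C L I \<phi> U) \<longleftrightarrow> forces C L I \<phi> A (\<lambda>y. ctx_var C L I U y \<cdot> k)"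
    "\<And>A k. k \<in> hom C A (ctx C L I U) \<Longrightarrow>
       lies_in C k (fm_sub C L I \<psi> U) \<longleftrightarrow> forces C L I \<psi> A (\<lambda>y. ctx_var C L I U y \<cdot> k)"
    using And by auto
  have F: "finite {fm_sub C L I \<phi> U, fm_sub C L I \<psi> U}"
    "{fm_sub C L I \<phi> U, fm_sub C L I \<psi> U} \<subseteq> carrier (Sub C (ctx C L I U))"
    using IH by auto
  show ?case
    using Inf_carrier[OF F U] lies_in_Inf[OF F U] f by (simp add: meet_def)
next
  case (Ex x \<phi>)
  have V: "finite (insert x U)" "free_vars \<phi> \<subseteq> insert x U"
    using Ex.prems by auto
  have S: "fm_sub C L I \<phi> (insert x U) \<in> carrier (Sub C (ctx C L I (insert x U)))"
    and fS: "\<And>A k. k \<in> hom C A (ctx C L I (insert x U)) \<Longrightarrow>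
      lies_in C k (fm_sub C L I \<phi> (insert x U)) \<longleftrightarrow>
      forces C L I \<phi> A (\<lambda>y. ctx_var C L I (insert x U) y \<cdot> k)"
    using Ex.IH[OF _ V] Ex.prems by auto
  show ?case
  proof (cases "x \<in> U")
    case False
    have UV: "U \<subseteq> insert x U" by auto
    show ?thesis
      using sub_image_carrier[OF ctx_proj_hom[OF UV V(1)] S] False
        sub_image_forces[OF Ex.prems(2) False S fS V(2)] by simp
  next
    \<comment> \<open>The bound variable shadows one of the context. The previous case is used over
      \<open>U - {x}\<close>, from which \<open>insert x\<close> leads back to \<open>U\<close>, and
      the result is weakened along the projection.\<close>
    case True
    let ?W = "U - {x}" and ?p = "ctx_proj C L I (U - {x}) U"
    have ins: "insert x U = U" "insert x ?W = U"
      using True by auto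
    have W: "?W \<subseteq> U" "finite ?W" "x \<notin> ?W"
      using Ex.prems(2) by auto
    note p = ctx_proj_hom[OF W(1) Ex.prems(2)]
    note T = sub_image_carrier[OF p S[unfolded ins]]
    have "lies_in C k (fm_sub C L I (Ex x \<phi>) U) \<longleftrightarrow>
        forces C L I (Ex x \<phi>) A (\<lambda>y. ctx_var C L I U y \<cdot> k)"
      if k: "k \<in> hom C A (ctx C L I U)" for A k
    proof -
      note pk = comp_hom[OF k p]
      have "lies_in C k (fm_sub C L I (Ex x \<phi>) U) \<longleftrightarrow>
          lies_in C (?p \<cdot> k) (sub_image C ?p (fm_sub C L I \<phi> U))"
        using lies_in_sub_pullback[OF p T k] True by simp
      also have "\<dots> \<longleftrightarrow> forces C L I (Ex x \<phi>) A (\<lambda>y. ctx_var C L I ?W y \<cdot> (?p \<cdot> k))"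
        by (rule sub_image_forces[OF W(2,3), unfolded ins, OF S[unfolded ins] fS[unfolded ins]
              V(2)[unfolded ins] pk])
      \<comment> \<open>Nothing is lost by dropping the component at \<open>x\<close>, which is not
        free in \<open>Ex x \<phi>\<close>.\<close>
      also have "\<dots> \<longleftrightarrow> forces C L I (Ex x \<phi>) A (\<lambda>y. ctx_var C L I U y \<cdot> k)"
        by (rule forces_cong, rule ctx_var_proj_comp[OF W(1) Ex.prems(2) k])
          (use Ex.prems(3) in auto)
      finally show ?thesis .
    qed
    then show ?thesis
      using sub_pullback_carrier[OF p T] True by simp
  qed
qed

lemma fm_sub_carrier:
  "\<phi> \<in> fms_in L U \<Longrightarrow> finite U \<Longrightarrow> fm_sub C L I \<phi> U \<in> carrier (Sub C (ctx C L I U))"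
  using fm_sub_sound by (auto simp: fms_in_def)

lemma lies_in_fm_sub:
  "\<phi> \<in> fms_in L U \<Longrightarrow> finite U \<Longrightarrow> k \<in> hom C A (ctx C L I U) \<Longrightarrow>
    lies_in C k (fm_sub C L I \<phi> U) \<longleftrightarrow> forces C L I \<phi> A (\<lambda>y. ctx_var C L I U y \<cdot> k)"
  using fm_sub_sound[of \<phi> U] by (simp add: fms_in_def)

text \<open>The projection leaves the components at variables of \<open>U\<close> unchanged, and
  these include all free variables of \<open>\<phi>\<close>; by \<open>forces_cong\<close> both
  sides have the same elements.\<close>

lemma fm_sub_weaken:
  assumes \<phi>: "\<phi> \<in> fms_in L U" and UV: "U \<subseteq> V" "finite V"
  shows "sub_pullback C (ctx_proj C L I U V) (fm_sub C L I \<phi> U) = fm_sub C L I \<phi> V"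
proof -
  note p = ctx_proj_hom[OF UV] and U = finite_subset[OF UV]
  note S = fm_sub_carrier[OF \<phi> U]
  have \<phi>V: "\<phi> \<in> fms_in L V" and fv: "free_vars \<phi> \<subseteq> U"
    using \<phi> UV(1) by (auto simp: fms_in_def)
  show ?thesis
  proof (rule Sub_eqI[OF sub_pullback_carrier[OF p S] fm_sub_carrier[OF \<phi>V UV(2)]])
    fix A k assume k: "k \<in> hom C A (ctx C L I V)"
    have "forces C L I \<phi> A (\<lambda>y. ctx_var C L I U y \<cdot> (ctx_proj C L I U V \<cdot> k)) \<longleftrightarrow>
        forces C L I \<phi> A (\<lambda>y. ctx_var C L I V y \<cdot> k)"
      by (rule forces_cong, rule ctx_var_proj_comp[OF UV k]) (use fv in auto)
    then show "lies_in C k (sub_pullback C (ctx_proj C L I U V) (fm_sub C L I \<phi> U)) \<longleftrightarrow>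
        lies_in C k (fm_sub C L I \<phi> V)"
      using lies_in_sub_pullback[OF p S k] lies_in_fm_sub[OF \<phi> U comp_hom[OF k p]]
        lies_in_fm_sub[OF \<phi>V UV(2) k] by simp
  qed
qed

end


section \<open>Soundness\<close>

context regular_category
begin

text \<open>Closure under binary meets extends to finite families by induction. For the empty family
  the infimum is the greatest subobject, which lies above any member of the nonempty filter.\<close>

lemma filter_Inf:
  assumes G: "is_filter (Sub C A) G" and F: "finite F" "F \<subseteq> G" and A: "A \<in> Ob C"
  shows "\<Sqinter>\<^bsub>Sub C A\<^esub> F \<in> G"
proof -
  have up: "T \<in> G" if "S \<in> G" "T \<in> carrier (Sub C A)" "S \<sqsubseteq>\<^bsub>Sub C A\<^esub> T" for S T
    using G that unfolding is_filter_def by blast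
  have car: "G \<subseteq> carrier (Sub C A)" and meet: "\<And>S T. S \<in> G \<Longrightarrow> T \<in> G \<Longrightarrow> S \<sqinter>\<^bsub>Sub C A\<^esub> T \<in> G"
    using G by (auto simp: is_filter_def)
  show ?thesis
    using F
  proof induction
    case empty
    obtain S where S: "S \<in> G"
      using G by (auto simp: is_filter_def)
    have e: "finite {}" "{} \<subseteq> carrier (Sub C A)" by auto
    show ?case
      using up[OF S] Inf_carrier[OF e A] lies_in_Inf[OF e A] S car by (simp add: Sub_le_iff subset_iff)
  next
    case (insert S F)
    let ?I = "\<Sqinter>\<^bsub>Sub C A\<^esub> F" and ?J = "\<Sqinter>\<^bsub>Sub C A\<^esub> (insert S F)"
    have FG: "finite F" "F \<subseteq> carrier (Sub C A)" "finite (insert S F)"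
      "insert S F \<subseteq> carrier (Sub C A)" and S: "S \<in> G"
      using insert car by auto
    note I = Inf_carrier[OF FG(1,2) A]
    have SI: "finite {S, ?I}" "{S, ?I} \<subseteq> carrier (Sub C A)"
      using S car I by auto
    have "S \<sqinter>\<^bsub>Sub C A\<^esub> ?I = ?J"
      unfolding meet_def
      by (rule Sub_eqI[OF Inf_carrier[OF SI A] Inf_carrier[OF FG(3,4) A]])
        (simp add: lies_in_Inf[OF SI A] lies_in_Inf[OF FG(3,4) A] lies_in_Inf[OF FG(1,2) A])
    then show ?case
      using meet[OF S insert.IH] insert.prems by simp
  qed
qed

end

text \<open>Membership is first carried down from \<open>U\<close> to \<open>U \<inter> V\<close>
  and then up to \<open>V\<close>, by reading the same equation for \<open>G\<close> in opposite
  directions.\<close>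

lemma (in regular_interp) filter_sat_of_base:
  assumes K: "simplicial_complex X K" and G: "filter_model C L I K G"
    and U: "U \<in> K" "\<phi> \<in> fms_in L U" "fm_sub C L I \<phi> U \<in> G U"
  shows "filter_sat C L I K G \<phi>"
  unfolding filter_sat_def
proof (intro ballI impI)
  fix V assume V: "V \<in> K" "\<phi> \<in> fms_in L V"
  let ?W = "U \<inter> V"
  have \<phi>W: "\<phi> \<in> fms_in L ?W"
    using U(2) V(2) by (auto simp: fms_in_def)
  have fin: "finite U" "finite V" "finite ?W"
    using K U(1) V(1) by (auto simp: simplicial_complex_def)
  have eq: "G ?W = {S \<in> carrier (Sub C (ctx C L I ?W)). sub_pullback C (ctx_proj C L I ?W Y) S \<in> G Y}"
    if "?W \<subseteq> Y" "Y \<in> K" for Y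
    using G that unfolding filter_model_def by blast
  have "fm_sub C L I \<phi> ?W \<in> G ?W"
    using eq[OF Int_lower1 U(1)] fm_sub_carrier[OF \<phi>W fin(3)] U(3)
      fm_sub_weaken[OF \<phi>W Int_lower1 fin(1)] by simp
  then show "fm_sub C L I \<phi> V \<in> G V"
    using eq[OF Int_lower2 V(1)] fm_sub_weaken[OF \<phi>W Int_lower2 fin(2)] by simp
qed

text \<open>Induction on the derivation for a fixed \<open>G\<close>. The assumption that
  \<open>G\<close> models the premises takes part in the induction, since a cut changes the set of
  premises.\<close>

lemma inchworm_sound:
  assumes K: "simplicial_complex X K" and reg: "regular_category C" and model: "is_model C L I ent"
    and inch: "inchworm L ent K \<Gamma> \<phi>" and G: "filter_model_of C L I K \<Gamma> G"
  shows "filter_sat C L I K G \<phi>"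
proof -
  interpret regular_interp C L I
    using reg model by (simp add: regular_interp_def regular_interp_axioms_def is_model_def)
  show ?thesis
    using inch G
  proof (induction rule: inchworm.induct)
    case (base \<Gamma> U \<phi>)
    obtain \<Delta> where \<Delta>: "finite \<Delta>" "\<Delta> \<subseteq> \<Gamma> \<inter> fms_in L U"
      and le: "\<And>V. finite V \<Longrightarrow> insert \<phi> \<Delta> \<subseteq> fms_in L V \<Longrightarrow>
        \<Sqinter>\<^bsub>Sub C (ctx C L I V)\<^esub> ((\<lambda>\<psi>. fm_sub C L I \<psi> V) ` \<Delta>)
          \<sqsubseteq>\<^bsub>Sub C (ctx C L I V)\<^esub> fm_sub C L I \<phi> V"
      using model base.hyps(4) unfolding is_model_def by metis
    have fin: "finite U"
      using K base.hyps(2) by (auto simp: simplicial_complex_def)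
    have GU: "is_filter (Sub C (ctx C L I U)) (G U)" and fm: "filter_model C L I K G"
      using base.prems base.hyps(2) unfolding filter_model_of_def filter_model_def by blast+
    have "(\<lambda>\<psi>. fm_sub C L I \<psi> U) ` \<Delta> \<subseteq> G U"
      using \<Delta>(2) base.prems base.hyps(2) by (auto simp: filter_model_of_def filter_sat_def)
    then have "\<Sqinter>\<^bsub>Sub C (ctx C L I U)\<^esub> ((\<lambda>\<psi>. fm_sub C L I \<psi> U) ` \<Delta>) \<in> G U"
      using filter_Inf[OF GU _ _ ctx_ob[OF fin]] \<Delta>(1) by blast
    moreover have "\<Sqinter>\<^bsub>Sub C (ctx C L I U)\<^esub> ((\<lambda>\<psi>. fm_sub C L I \<psi> U) ` \<Delta>)
        \<sqsubseteq>\<^bsub>Sub C (ctx C L I U)\<^esub> fm_sub C L I \<phi> U"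
      \<comment> \<open>The entailment is evaluated in the context \<open>U\<close> of the base
        step, which contains the free variables of \<open>\<Delta>\<close> and of
        \<open>\<phi>\<close>.\<close>
      by (rule le[OF fin]) (use \<Delta>(2) base.hyps(3) in auto)
    ultimately have "fm_sub C L I \<phi> U \<in> G U"
      using GU fm_sub_carrier[OF base.hyps(3) fin] unfolding is_filter_def by blast
    then show ?case
      by (rule filter_sat_of_base[OF K fm base.hyps(2,3)])
  next
    \<comment> \<open>The first derivation makes \<open>\<phi>\<close> valid in \<open>G\<close>, so
      \<open>G\<close> is also a filter model of the premises \<open>insert \<phi> \<Delta>\<close>
      of the second.\<close>
    case (cut \<Gamma> \<phi> \<Delta> \<psi>)
    then show ?case by (auto simp: filter_model_of_def)
  qed
qed

theorem theorem28:
  fixes S :: "('o, 'a) cat"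
    and L :: "('s, 'f, 'r, 'v) lang"
    and ent :: "('f, 'r, 'v) fm set \<Rightarrow> ('f, 'r, 'v) fm \<Rightarrow> bool"
    and I :: "('o, 'a, 's, 'f, 'r) interp"
    and X :: "'v set"
    and K :: "'v set set"
  assumes "simplicial_complex X K"
    and "regular_theory L ent"
    and "regular_category S"
    and "is_model S L I ent"
  shows "\<forall>\<Gamma> \<phi>. \<Gamma> \<subseteq> fms_over L K \<longrightarrow> \<phi> \<in> fms_over L K \<longrightarrow> inchworm L ent K \<Gamma> \<phi> \<longrightarrow>
    (\<forall>G. filter_model_of S L I K \<Gamma> G \<longrightarrow> filter_sat S L I K G \<phi>)"
  using inchworm_sound[OF assms(1,3,4)] by blast

end
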